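(* Let $\varepsilon>0$ and let $\rho_{A_1\ldots A_m}$ be a quantum $\varepsilon$-approximate Markov chain on a 1D open chain $A_1A_2\ldots A_m$, i.e. a density matrix on $\mathcal{H}_{A_1}\otimes\cdots\otimes\mathcal{H}_{A_m}$ with $$I(A_1\ldots A_{i-1}:A_{i+1}\ldots A_m\,|\,A_i)_\rho\le\varepsilon\qquad\forall i\in[1,m].$$ Then there exists a short-range Hamiltonian (Hermitian operator) $H=\sum_{i=1}^{m-1}h_{A_i,A_{i+1}}$ with $\mathrm{supp}(h_{A_i,A_{i+1}})=A_iA_{i+1}$, such that $$S\left(\rho\,\Big\|\,\frac{e^{-H}}{Z}\right)\le\varepsilon m,\qquad Z=\mathrm{Tr}\,e^{-H}.$$
   Context: All Hilbert spaces $\mathcal{H}_{A_i}$ are finite-dimensional; $\rho$ need not have full rank. $\log$ has base 2. The von Neumann entropy is $S(X)_\rho=-\mathrm{Tr}(\rho_X\log\rho_X)$, where $\rho_X$ is the reduced state on subsystem $X$. The conditional mutual information is $I(A:C|B)_\rho=S(AB)_\rho+S(BC)_\rho-S(ABC)_\rho-S(B)_\rho$ (equal to $0$ if $A$ or $C$ is the empty system). The relative entropy is $S(\rho\|\sigma)=\mathrm{Tr}(\rho(\log\rho-\log\sigma))$ if the range of $\rho$ is contained in the range of $\sigma$, and $+\infty$ otherwise. "$\mathrm{supp}(O)=X$" means that $O=O_X\otimes 1_{X^c}$ for some operator $O_X$ on $\mathcal{H}_X$, i.e. $O$ acts only on the subsystem $X$.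
   Formalization: The chain is assumed to have at least two sites (m ≥ 2): for m = 1 the sum for H is empty, so H = 0, and the bound fails, e.g. for a pure qubit state with ε = 1/2, where the relative entropy to 1/2 equals 1. *)

theory Defs
  imports "Jordan_Normal_Form.Schur_Decomposition" "HOL-Library.Extended_Real" "HOL.Transcendental"
begin

section \<open>Finite-dimensional operators\<close>

text \<open>An operator on an \<open>n\<close>-dimensional Hilbert space is a complex \<open>n \<times> n\<close> matrix with respect to
  a fixed orthonormal basis.\<close>

definition hermitian :: "complex mat \<Rightarrow> bool" where
  "hermitian A \<longleftrightarrow> square_mat A \<and> mat_adjoint A = A"

definition positive_operator :: "complex mat \<Rightarrow> bool" where
  "positive_operator A \<longleftrightarrow>
     hermitian A \<and> (\<forall>v \<in> carrier_vec (dim_row A). 0 \<le> Re ((A *\<^sub>v v) \<bullet>c v))"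

definition mat_trace :: "complex mat \<Rightarrow> complex" where
  "mat_trace A = (\<Sum>i<dim_row A. A $$ (i, i))"

definition density_operator :: "nat \<Rightarrow> complex mat \<Rightarrow> bool" where
  "density_operator n A \<longleftrightarrow> A \<in> carrier_mat n n \<and> positive_operator A \<and> mat_trace A = 1"

definition mat_range :: "complex mat \<Rightarrow> complex vec set" where
  "mat_range A = (\<lambda>v. A *\<^sub>v v) ` carrier_vec (dim_col A)"

definition mat_sum :: "nat \<Rightarrow> ('i \<Rightarrow> complex mat) \<Rightarrow> 'i set \<Rightarrow> complex mat" where
  "mat_sum n F I = mat n n (\<lambda>(k, l). \<Sum>i\<in>I. F i $$ (k, l))"

definition mat_exp :: "complex mat \<Rightarrow> complex mat" where
  "mat_exp A = mat (dim_row A) (dim_row A) (\<lambda>(i, j). \<Sum>k. (A ^\<^sub>m k) $$ (i, j) / fact k)"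

text \<open>Spectral functional calculus \<open>f(A) = U diag(f(\<lambda>\<^sub>i)) U\<^sup>*\<close> for a Hermitian
  \<open>A = U diag(\<lambda>\<^sub>i) U\<^sup>*\<close> with \<open>U\<close> unitary. The result does not depend on the choice of the
  diagonalisation.\<close>

definition mat_fun :: "(real \<Rightarrow> real) \<Rightarrow> complex mat \<Rightarrow> complex mat" where
  "mat_fun f A = (SOME B. \<exists>U (e :: nat \<Rightarrow> real).
     U \<in> carrier_mat (dim_row A) (dim_row A) \<and>
     mat_adjoint U * U = 1\<^sub>m (dim_row A) \<and>
     A = U * mat_diag (dim_row A) (\<lambda>i. complex_of_real (e i)) * mat_adjoint U \<and>
     B = U * mat_diag (dim_row A) (\<lambda>i. complex_of_real (f (e i))) * mat_adjoint U)"

text \<open>Since \<open>log 2 0 = 0\<close> in HOL, this is the logarithm on the range of a positive operator and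
  zero on its kernel; in particular the convention \<open>0 log 0 = 0\<close> holds below.\<close>

definition mat_log2 :: "complex mat \<Rightarrow> complex mat" where
  "mat_log2 A = mat_fun (log 2) A"

definition vn_entropy :: "complex mat \<Rightarrow> real" where
  "vn_entropy A = - Re (mat_trace (A * mat_log2 A))"

definition rel_entropy :: "complex mat \<Rightarrow> complex mat \<Rightarrow> ereal" where
  "rel_entropy A B =
     (if mat_range A \<subseteq> mat_range B
      then ereal (Re (mat_trace (A * (mat_log2 A - mat_log2 B)))) else \<infinity>)"

definition gibbs_state :: "complex mat \<Rightarrow> complex mat" where
  "gibbs_state H = (1 / mat_trace (mat_exp (- H))) \<cdot>\<^sub>m mat_exp (- H)"

section \<open>Chains of subsystems\<close>

text \<open>Site \<open>j \<in> {1..m}\<close> carries the Hilbert space of dimension \<open>d j\<close>. For a set \<open>X\<close> of sites, the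
  product basis of the tensor product of the sites in \<open>X\<close> is numbered by
  \<open>0, \<dots>, (\<Prod>j\<in>X. d j) - 1\<close> in mixed radix, the lowest site being the least significant digit.
  Thus \<open>site_index d j k\<close> is the basis label at site \<open>j\<close> of the \<open>k\<close>-th basis vector of the whole
  chain, and \<open>sub_index d X k\<close> is the number of the restriction of that basis vector to \<open>X\<close>.\<close>

definition sub_dim :: "(nat \<Rightarrow> nat) \<Rightarrow> nat set \<Rightarrow> nat" where
  "sub_dim d X = (\<Prod>j\<in>X. d j)"

definition site_index :: "(nat \<Rightarrow> nat) \<Rightarrow> nat \<Rightarrow> nat \<Rightarrow> nat" where
  "site_index d j k = (k div sub_dim d {1..<j}) mod d j"

definition sub_index :: "(nat \<Rightarrow> nat) \<Rightarrow> nat set \<Rightarrow> nat \<Rightarrow> nat" where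
  "sub_index d X k = (\<Sum>j\<in>X. site_index d j k * sub_dim d {l \<in> X. l < j})"

text \<open>The partial trace over the complement of \<open>X\<close>: the entry at \<open>(a, b)\<close> sums
  \<open>\<langle>a, c| \<rho> |b, c\<rangle>\<close> over all basis labels \<open>c\<close> of the complement.\<close>

definition reduced_state :: "(nat \<Rightarrow> nat) \<Rightarrow> nat \<Rightarrow> nat set \<Rightarrow> complex mat \<Rightarrow> complex mat" where
  "reduced_state d m X \<rho> = mat (sub_dim d X) (sub_dim d X) (\<lambda>(a, b).
     \<Sum>(k, l) | k < sub_dim d {1..m} \<and> l < sub_dim d {1..m} \<and>
              sub_index d X k = a \<and> sub_index d X l = b \<and>
              sub_index d ({1..m} - X) k = sub_index d ({1..m} - X) l. \<rho> $$ (k, l))"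

text \<open>The operator \<open>O\<^sub>X \<otimes> 1\<close>, with the identity on the complement of \<open>X\<close>.\<close>

definition extend_op :: "(nat \<Rightarrow> nat) \<Rightarrow> nat \<Rightarrow> nat set \<Rightarrow> complex mat \<Rightarrow> complex mat" where
  "extend_op d m X A = mat (sub_dim d {1..m}) (sub_dim d {1..m}) (\<lambda>(k, l).
     if sub_index d ({1..m} - X) k = sub_index d ({1..m} - X) l
     then A $$ (sub_index d X k, sub_index d X l) else 0)"

definition supported_on :: "(nat \<Rightarrow> nat) \<Rightarrow> nat \<Rightarrow> nat set \<Rightarrow> complex mat \<Rightarrow> bool" where
  "supported_on d m X A \<longleftrightarrow>
     (\<exists>A\<^sub>X \<in> carrier_mat (sub_dim d X) (sub_dim d X). A = extend_op d m X A\<^sub>X)"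

definition sub_entropy :: "(nat \<Rightarrow> nat) \<Rightarrow> nat \<Rightarrow> complex mat \<Rightarrow> nat set \<Rightarrow> real" where
  "sub_entropy d m \<rho> X = vn_entropy (reduced_state d m X \<rho>)"

text \<open>\<open>cond_mutual_info d m \<rho> A C B\<close> is \<open>I(A:C|B)\<^sub>\<rho>\<close> for pairwise disjoint \<open>A, B, C \<subseteq> {1..m}\<close>.\<close>

definition cond_mutual_info ::
    "(nat \<Rightarrow> nat) \<Rightarrow> nat \<Rightarrow> complex mat \<Rightarrow> nat set \<Rightarrow> nat set \<Rightarrow> nat set \<Rightarrow> real" where
  "cond_mutual_info d m \<rho> A C B =
     sub_entropy d m \<rho> (A \<union> B) + sub_entropy d m \<rho> (B \<union> C)
     - sub_entropy d m \<rho> (A \<union> B \<union> C) - sub_entropy d m \<rho> B"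

definition approx_markov_chain :: "(nat \<Rightarrow> nat) \<Rightarrow> nat \<Rightarrow> real \<Rightarrow> complex mat \<Rightarrow> bool" where
  "approx_markov_chain d m \<epsilon> \<rho> \<longleftrightarrow>
     density_operator (sub_dim d {1..m}) \<rho> \<and>
     (\<forall>i\<in>{1..m}. cond_mutual_info d m \<rho> {1..<i} {i<..m} {i} \<le> \<epsilon>)"

end

theory Submission
  imports Defs
begin

text \<open>
  Put \<open>\<sigma> = (1 - \<delta>) \<rho> + \<delta> 1 / dim\<close> and
  \<open>H = - \<Sum>\<^sub>i ln \<sigma>\<^bsub>i,i+1\<^esub> + \<Sum>\<^bsub>1<i<m\<^esub> ln \<sigma>\<^sub>i\<close>, the exact Hamiltonian of a full-rank
  Markov chain. Up to a multiple of \<open>- ln (1 - \<delta>)\<close>, \<open>Tr \<rho> ln \<rho> + Tr \<rho> H\<close> is a sum of differences of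
  entropies, which strong subadditivity bounds by the sum of the conditional mutual informations
  for \<open>1 < i < m\<close>. That sum is at most \<open>(m - 2) \<epsilon>\<close>, and the remaining slack absorbs \<open>\<delta>\<close>.
  It remains to see that \<open>Z \<le> 1\<close>: for the Gibbs state \<open>\<tau>\<close>,
  \<open>ln Z = - Tr \<tau> ln \<tau> - Tr \<tau> H\<close>, and this is nonpositive by adding the sites one after the other and
  comparing \<open>S(\<tau> \<parallel> 1 \<otimes> \<sigma>\<^bsub>k,k+1\<^esub>)\<close> on the first \<open>k + 1\<close> sites with
  \<open>S(\<tau> \<parallel> 1 \<otimes> \<sigma>\<^sub>k)\<close> on the first \<open>k\<close>.

  So everything rests on the monotonicity of the relative entropy under partial traces. It follows
  from the representation of \<open>S(A \<parallel> B)\<close> by the quadratic forms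
  \<open>Tr A (L\<^sub>B + t R\<^sub>A)\<^sup>-\<^sup>1 A\<close>, \<open>t \<ge> 0\<close>, each of which is a supremum over operators \<open>X\<close> of
  functions that are affine in \<open>A\<close> and \<open>B\<close>; the partial trace restricts \<open>X\<close> to a subalgebra.
\<close>

section \<open>Matrices\<close>

text \<open>The obstacle is the kernel that \<open>\<rho>\<close> may have: a Gibbs state always has
  full rank, so no \<open>H\<close> reproduces a singular \<open>\<rho>\<close>, and the
  monotonicity argument needs a strictly positive second argument. Mixing with the maximally mixed
  state suits a local construction for two reasons. It commutes with partial traces, so each
  marginal of \<open>\<sigma>\<close> is the same perturbation of the marginal of
  \<open>\<rho>\<close>. And the two marginals share an eigenbasis, so
  \<open>Tr \<rho> ln \<sigma>\<close> differs from \<open>Tr \<rho> ln \<rho>\<close> by at most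
  \<open>- ln (1 - \<delta>)\<close>, whatever the dimension and the rank. Only the
  \<open>m - 1\<close> two-site terms pay this price; with
  \<open>- ln (1 - \<delta>) = \<epsilon> ln 2 / m\<close> they cost less than one
  \<open>\<epsilon>\<close> in bits. The partition function needs its own argument because
  \<open>S(\<rho> \<parallel> e^(-H) / Z)\<close> contains the summand \<open>ln Z\<close>. For a
  full-rank exact Markov chain \<open>e^(-H)\<close> is the state itself and \<open>Z = 1\<close>;
  for an approximate one, knowledge of \<open>\<rho>\<close> alone does not control
  \<open>Z\<close>. Hence the bound \<open>- Tr \<tau> H \<le> Tr \<tau> ln \<tau>\<close> is proved
  for every state \<open>\<tau>\<close> and then applied to the Gibbs state.\<close>

lemma mat_adjoint_carrier [simp]: "A \<in> carrier_mat n k \<Longrightarrow> mat_adjoint A \<in> carrier_mat k n"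
  unfolding mat_adjoint_def by (auto simp: mat_of_rows_def)

lemma mat_adjoint_dim [simp]: "dim_row (mat_adjoint A) = dim_col A" "dim_col (mat_adjoint A) = dim_row A"
  unfolding mat_adjoint_def by (auto simp: mat_of_rows_def)

lemma mat_adjoint_index [simp]:
  assumes "i < dim_col A" "j < dim_row A"
  shows "mat_adjoint A $$ (i, j) = conjugate (A $$ (j, i))"
  using assms unfolding mat_adjoint_def by (simp add: mat_of_rows_def)

lemma mult_square_carrier [simp]:
  "A \<in> carrier_mat n n \<Longrightarrow> B \<in> carrier_mat n n \<Longrightarrow> A * B \<in> carrier_mat n n"
  by (rule mult_carrier_mat)

lemma index_mult_mat_sum:
  assumes "A \<in> carrier_mat n k" "B \<in> carrier_mat k l" "i < n" "j < l"
  shows "(A * B) $$ (i, j) = (\<Sum>x<k. A $$ (i, x) * B $$ (x, j))"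
  using assms by (auto simp: scalar_prod_def atLeast0LessThan)

lemma mat_adjoint_mat_adjoint [simp]: "mat_adjoint (mat_adjoint (A :: complex mat)) = A"
  by (rule eq_matI) auto

lemma mat_adjoint_mult:
  assumes "(A :: complex mat) \<in> carrier_mat n k" "B \<in> carrier_mat k l"
  shows "mat_adjoint (A * B) = mat_adjoint B * mat_adjoint A"
proof (rule eq_matI)
  fix i j assume "i < dim_row (mat_adjoint B * mat_adjoint A)" "j < dim_col (mat_adjoint B * mat_adjoint A)"
  then have ij: "i < l" "j < n" using assms by auto
  have "mat_adjoint (A * B) $$ (i, j) = cnj ((A * B) $$ (j, i))" using assms ij by simp
  also have "\<dots> = (\<Sum>x<k. cnj (B $$ (x, i)) * cnj (A $$ (j, x)))"
    using ij by (simp add: index_mult_mat_sum[OF assms] mult.commute)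
  also have "\<dots> = (\<Sum>x<k. mat_adjoint B $$ (i, x) * mat_adjoint A $$ (x, j))"
    using assms ij by (intro sum.cong) auto
  also have "\<dots> = (mat_adjoint B * mat_adjoint A) $$ (i, j)"
    using index_mult_mat_sum[of "mat_adjoint B" l k "mat_adjoint A" n] assms ij by auto
  finally show "mat_adjoint (A * B) $$ (i, j) = (mat_adjoint B * mat_adjoint A) $$ (i, j)" .
qed (use assms in auto)

lemma mat_adjoint_add:
  assumes "(A :: complex mat) \<in> carrier_mat n k" "B \<in> carrier_mat n k"
  shows "mat_adjoint (A + B) = mat_adjoint A + mat_adjoint B"
  by (rule eq_matI) (use assms in auto)

lemma mat_adjoint_uminus: "mat_adjoint (- (A :: complex mat)) = - mat_adjoint A"
  by (rule eq_matI) auto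

lemma mat_adjoint_one [simp]: "mat_adjoint (1\<^sub>m n :: complex mat) = 1\<^sub>m n"
  by (rule eq_matI) auto

abbreviation real_diag :: "nat \<Rightarrow> (nat \<Rightarrow> real) \<Rightarrow> complex mat" where
  "real_diag n e \<equiv> mat_diag n (\<lambda>i. complex_of_real (e i))"

lemma mat_diag_dims [simp]: "dim_row (mat_diag n f) = n" "dim_col (mat_diag n f) = n"
  by (simp_all add: mat_diag_def)

lemma mat_adjoint_real_diag [simp]: "mat_adjoint (real_diag n e) = real_diag n e"
  by (rule eq_matI) (auto simp: mat_diag_def)

lemma mat_trace_mult:
  assumes "A \<in> carrier_mat n k" "B \<in> carrier_mat k n"
  shows "mat_trace (A * B) = (\<Sum>i<n. \<Sum>j<k. A $$ (i, j) * B $$ (j, i))"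
  unfolding mat_trace_def using assms by (auto intro!: sum.cong simp: index_mult_mat_sum[OF assms] simp del: index_mult_mat(1))

lemma mat_trace_mult_comm:
  assumes "A \<in> carrier_mat n k" "B \<in> carrier_mat k n"
  shows "mat_trace (A * B) = mat_trace (B * A)"
  unfolding mat_trace_mult[OF assms] mat_trace_mult[OF assms(2,1)]
  by (subst sum.swap) (simp add: mult.commute)

lemma mat_trace_add:
  assumes "A \<in> carrier_mat n n" "B \<in> carrier_mat n n"
  shows "mat_trace (A + B) = mat_trace A + mat_trace B"
  using assms unfolding mat_trace_def by (simp add: sum.distrib)

lemma mat_trace_minus:
  assumes "A \<in> carrier_mat n n" "B \<in> carrier_mat n n"
  shows "mat_trace (A - B) = mat_trace A - mat_trace B"
  using assms unfolding mat_trace_def by (simp add: sum_subtractf)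

lemma mat_trace_uminus:
  assumes "A \<in> carrier_mat n n"
  shows "mat_trace (- A) = - mat_trace A"
  using assms unfolding mat_trace_def by (simp add: sum_negf)

lemma mat_trace_smult:
  assumes "A \<in> carrier_mat n n"
  shows "mat_trace (c \<cdot>\<^sub>m A) = c * mat_trace A"
  using assms unfolding mat_trace_def by (simp add: sum_distrib_left)

section \<open>The spectral theorem\<close>

text \<open>Eigenvalues follow the order of the columns of \<open>U\<close>, so commuting operators
  are expressed by one \<open>U\<close> with several eigenvalue functions.\<close>

definition diagonalizes :: "nat \<Rightarrow> complex mat \<Rightarrow> (nat \<Rightarrow> real) \<Rightarrow> complex mat \<Rightarrow> bool" where
  "diagonalizes n U e A \<longleftrightarrow> U \<in> carrier_mat n n \<and> mat_adjoint U * U = 1\<^sub>m n \<and>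
     A = U * real_diag n e * mat_adjoint U"

lemma diagonalizesD:
  assumes "diagonalizes n U e A"
  shows "U \<in> carrier_mat n n" "mat_adjoint U * U = 1\<^sub>m n" "U * mat_adjoint U = 1\<^sub>m n"
    "A = U * real_diag n e * mat_adjoint U" "A \<in> carrier_mat n n"
proof -
  show U: "U \<in> carrier_mat n n" "mat_adjoint U * U = 1\<^sub>m n" "A = U * real_diag n e * mat_adjoint U"
    using assms by (auto simp: diagonalizes_def)
  then show "U * mat_adjoint U = 1\<^sub>m n" using mat_mult_left_right_inverse[of "mat_adjoint U" n U] by auto
  show "A \<in> carrier_mat n n" using U mat_diag_dim[of n "\<lambda>i. complex_of_real (e i)"] by auto
qed

lemma hermitianI: "A \<in> carrier_mat n n \<Longrightarrow> mat_adjoint A = A \<Longrightarrow> hermitian A"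
  by (simp add: hermitian_def)

lemma hermitianD: "hermitian A \<Longrightarrow> mat_adjoint A = A" "hermitian A \<Longrightarrow> dim_row A = dim_col A"
  by (auto simp: hermitian_def)

lemma hermitian_index: 
  assumes "hermitian A" "A \<in> carrier_mat n n" "i < n" "j < n"
  shows "A $$ (i, j) = cnj (A $$ (j, i))"
proof -
  have "mat_adjoint A $$ (i, j) = cnj (A $$ (j, i))" using assms by simp
  then show ?thesis using hermitianD(1)[OF assms(1)] by simp
qed

lemma diagonalizes_hermitian:
  assumes "diagonalizes n U e A"
  shows "hermitian A"
proof (rule hermitianI)
  note U = diagonalizesD[OF assms]
  show "A \<in> carrier_mat n n" by fact
  have "mat_adjoint A = U * (real_diag n e * mat_adjoint U)"
    unfolding U(4) using U(1) mat_diag_dim[of n "\<lambda>i. complex_of_real (e i)"]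
    by (subst mat_adjoint_mult[of _ n n _ n], auto, subst mat_adjoint_mult[of _ n n _ n], auto)
  also have "\<dots> = A"
    unfolding U(4) using U(1) mat_diag_dim[of n "\<lambda>i. complex_of_real (e i)"]
    by (intro assoc_mult_mat[symmetric, of _ n n _ n _ n]) auto
  finally show "mat_adjoint A = A" .
qed

text \<open>Over the complex numbers the characteristic polynomial has a root. Its eigenvector is
  completed to a basis and orthogonalised, which leaves the first vector unchanged.\<close>

lemma unitary_with_first_eigenvector:
  assumes A: "(A :: complex mat) \<in> carrier_mat (Suc n) (Suc n)"
  obtains W e where "W \<in> carrier_mat (Suc n) (Suc n)" "mat_adjoint W * W = 1\<^sub>m (Suc n)"
    "A *\<^sub>v col W 0 = e \<cdot>\<^sub>v col W 0"
proof -
  let ?n = "Suc n"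
  obtain es where es: "char_poly A = (\<Prod>a\<leftarrow>es. [:- a, 1:])" "length es = ?n"
    using char_poly_factorized[OF A] by auto
  then obtain e es' where "es = e # es'" by (cases es) auto
  with es have "eigenvalue A e" using eigenvalue_root_char_poly[OF A] by auto
  then obtain v where "eigenvector A v e" unfolding eigenvalue_def by auto
  then have v: "v \<in> carrier_vec ?n" "v \<noteq> 0\<^sub>v ?n" "A *\<^sub>v v = e \<cdot>\<^sub>v v"
    using A unfolding eigenvector_def by auto
  define b where "b = basis_completion v"
  define ws where "ws = gram_schmidt ?n b"
  interpret cof_vec_space ?n "TYPE(complex)" .
  from basis_completion[OF v(1,2), folded b_def]
  have b: "distinct b" "\<not> lin_dep (set b)" "set b \<subseteq> carrier_vec ?n" "hd b = v" "length b = ?n" by auto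
  then obtain vs where bv: "b = v # vs" by (cases b) auto
  from gram_schmidt_result[OF b(3,1,2) refl, folded ws_def]
  have ws: "set ws \<subseteq> carrier_vec ?n" "corthogonal ws" "length ws = ?n" by (auto simp: b(5))
  from gram_schmidt_hd[OF v(1), of vs, folded bv] have hd: "hd ws = v" unfolding ws_def .
  then have ws0: "ws ! 0 = v" using ws(3) by (cases ws) auto
  have wsc: "ws ! i \<in> carrier_vec ?n" if "i < ?n" for i using ws that by auto
  \<comment> \<open>The Gram-Schmidt vectors are orthogonal but not normalised; \<open>c\<close>
    rescales them to unit length.\<close>
  define c where "c i = complex_of_real (1 / sqrt (Re (ws ! i \<bullet>c ws ! i)))" for i
  define W where "W = mat ?n ?n (\<lambda>(i, j). c j * (ws ! j) $ i)"
  have Wc: "W \<in> carrier_mat ?n ?n" unfolding W_def by simp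
  have "mat_adjoint W * W = 1\<^sub>m ?n"
  proof (rule eq_matI)
    fix i j assume "i < dim_row (1\<^sub>m ?n :: complex mat)" "j < dim_col (1\<^sub>m ?n :: complex mat)"
    then have ij: "i < ?n" "j < ?n" by auto
    have "(mat_adjoint W * W) $$ (i, j) = (\<Sum>x<?n. cnj (W $$ (x, i)) * W $$ (x, j))"
      using index_mult_mat_sum[of "mat_adjoint W" ?n ?n W ?n i j] Wc ij by simp
    also have "\<dots> = (\<Sum>x<?n. c i * c j * ((ws ! j) $ x * cnj ((ws ! i) $ x)))"
      using ij by (intro sum.cong) (auto simp: W_def c_def)
    also have "\<dots> = c i * c j * (ws ! j \<bullet>c ws ! i)"
      using wsc[OF ij(1)] by (simp add: scalar_prod_def sum_distrib_left atLeast0LessThan del: sum.lessThan_Suc)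
    also have "\<dots> = (if i = j then 1 else 0)"
    proof (cases "i = j")
      case True
      let ?s = "ws ! i \<bullet>c ws ! i"
      have "?s \<ge> 0" by (rule conjugate_square_ge_0_vec)
      moreover have "?s \<noteq> 0" using ws(2,3) ij unfolding corthogonal_def by auto
      ultimately have s: "?s = complex_of_real (Re ?s)" "Re ?s > 0"
        by (auto simp: complex_eq_iff less_eq_complex_def)
      have "c i * c i * ?s = complex_of_real (1 / sqrt (Re ?s) * (1 / sqrt (Re ?s)) * Re ?s)"
        unfolding c_def by (subst (3) s(1)) (simp only: of_real_mult)
      also have "\<dots> = 1" using s(2) by simp
      finally show ?thesis using True by simp
    next
      case False
      then have "ws ! j \<bullet>c ws ! i = 0" using ws(2,3) ij unfolding corthogonal_def by auto
      then show ?thesis using False by simp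
    qed
    finally show "(mat_adjoint W * W) $$ (i, j) = 1\<^sub>m ?n $$ (i, j)" using ij by simp
  qed (use Wc in auto)
  moreover have "A *\<^sub>v col W 0 = e \<cdot>\<^sub>v col W 0"
  proof -
    have "col W 0 = c 0 \<cdot>\<^sub>v v" by (rule eq_vecI) (use v in \<open>auto simp: W_def ws0\<close>)
    then show ?thesis using v A by (simp add: mult_mat_vec smult_smult_assoc mult.commute)
  qed
  ultimately show ?thesis using that Wc by blast
qed

text \<open>Conjugating with a unitary whose first column is an eigenvector clears the first column
  below the diagonal. Hermiticity then clears the first row and makes the corner entry real, so the
  induction hypothesis applies to the remaining block.\<close>

theorem hermitian_diagonalizes:
  assumes "A \<in> carrier_mat n n" "hermitian A"
  obtains U e where "diagonalizes n U e A"
  using assms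
proof (induction n arbitrary: A thesis)
  case 0
  have "diagonalizes 0 (1\<^sub>m 0) (\<lambda>_. 0) A"
    using 0 unfolding diagonalizes_def by auto
  then show ?case by (rule 0)
next
  case (Suc n)
  note A = Suc(3)
  from unitary_with_first_eigenvector[OF A] obtain W e where
    W: "W \<in> carrier_mat (Suc n) (Suc n)" "mat_adjoint W * W = 1\<^sub>m (Suc n)"
    and ev: "A *\<^sub>v col W 0 = e \<cdot>\<^sub>v col W 0" by blast
  have W3: "W * mat_adjoint W = 1\<^sub>m (Suc n)"
    using mat_mult_left_right_inverse[of "mat_adjoint W" "Suc n" W] W by auto
  define B where "B = mat_adjoint W * A * W"
  have B: "B \<in> carrier_mat (Suc n) (Suc n)" using W A by (simp add: B_def)
  have assB: "B = mat_adjoint W * (A * W)"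
    unfolding B_def using W A by (intro assoc_mult_mat[of _ "Suc n" "Suc n" _ "Suc n" _ "Suc n"]) auto
  have Bh: "mat_adjoint B = B"
  proof -
    have "mat_adjoint B = mat_adjoint W * mat_adjoint (mat_adjoint W * A)"
      unfolding B_def using W A by (intro mat_adjoint_mult) auto
    also have "mat_adjoint (mat_adjoint W * A) = A * W"
      using W A hermitianD(1)[OF Suc(4)] by (subst mat_adjoint_mult[of _ "Suc n" "Suc n" _ "Suc n"]) auto
    finally show ?thesis using assB by simp
  qed
  have B0: "B $$ (i, 0) = (if i = 0 then e else 0)" if "i < Suc n" for i
  proof -
    have "B $$ (i, 0) = row (mat_adjoint W) i \<bullet> col (A * W) 0" unfolding assB using W A that by auto
    also have "col (A * W) 0 = A *\<^sub>v col W 0" using W A by auto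
    also have "row (mat_adjoint W) i \<bullet> (A *\<^sub>v col W 0) = e * (row (mat_adjoint W) i \<bullet> col W 0)"
      unfolding ev using W that by (auto simp: scalar_prod_smult_distrib[of _ "Suc n"])
    also have "row (mat_adjoint W) i \<bullet> col W 0 = (mat_adjoint W * W) $$ (i, 0)" using W(1) that by auto
    finally show ?thesis using W(2) that by auto
  qed
  have Bcnj: "B $$ (i, j) = cnj (B $$ (j, i))" if "i < Suc n" "j < Suc n" for i j
    using arg_cong[OF Bh, of "\<lambda>M. M $$ (i, j)"] B that by auto
  have e: "e = complex_of_real (Re e)" using Bcnj[of 0 0] B0[of 0] by (simp add: complex_eq_iff)
  have B0': "B $$ (0, i) = (if i = 0 then e else 0)" if "i < Suc n" for i
    using Bcnj[of 0 i] B0[of i] that e by (auto simp: complex_eq_iff)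
  define C where "C = mat n n (\<lambda>(i, j). B $$ (Suc i, Suc j))"
  have C: "C \<in> carrier_mat n n" by (simp add: C_def)
  have "hermitian C"
  proof (rule hermitianI[OF C], rule eq_matI)
    fix i j assume "i < dim_row C" "j < dim_col C"
    then show "mat_adjoint C $$ (i, j) = C $$ (i, j)" using C Bcnj[of "Suc i" "Suc j"] by (simp add: C_def)
  qed (use C in auto)
  from Suc(1)[OF _ C this] obtain U f where Uf: "diagonalizes n U f C" by blast
  note U = diagonalizesD[OF Uf]
  define V where "V = mat (Suc n) (Suc n) (\<lambda>(i, j). if i = 0 \<or> j = 0 then if i = j then 1 else 0 else U $$ (i - 1, j - 1))"
  define g where "g i = (if i = 0 then Re e else f (i - 1))" for i
  have V: "V \<in> carrier_mat (Suc n) (Suc n)" by (simp add: V_def)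
  have VV: "mat_adjoint V * V = 1\<^sub>m (Suc n)"
  proof (rule eq_matI)
    fix i j assume "i < dim_row (1\<^sub>m (Suc n) :: complex mat)" "j < dim_col (1\<^sub>m (Suc n) :: complex mat)"
    then have ij: "i < Suc n" "j < Suc n" by auto
    have UU: "(\<Sum>x<n. cnj (U $$ (x, i)) * U $$ (x, j)) = (if i = j then 1 else 0)" if "i < n" "j < n" for i j
      using index_mult_mat_sum[of "mat_adjoint U" n n U n i j] U that by simp
    have "(mat_adjoint V * V) $$ (i, j) = (\<Sum>x<Suc n. cnj (V $$ (x, i)) * V $$ (x, j))"
      using index_mult_mat_sum[of "mat_adjoint V" "Suc n" "Suc n" V "Suc n" i j] V ij by simp
    also have "\<dots> = (if i = j then 1 else 0)"
      unfolding sum.lessThan_Suc_shift using ij UU[of "i - 1" "j - 1"]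
      by (cases i; cases j) (auto simp: V_def)
    finally show "(mat_adjoint V * V) $$ (i, j) = 1\<^sub>m (Suc n) $$ (i, j)" using ij by simp
  qed (use V in auto)
  have BV: "B = V * real_diag (Suc n) g * mat_adjoint V"
  proof (rule eq_matI)
    fix i j assume "i < dim_row (V * real_diag (Suc n) g * mat_adjoint V)" "j < dim_col (V * real_diag (Suc n) g * mat_adjoint V)"
    then have ij: "i < Suc n" "j < Suc n" using V by auto
    have "(V * real_diag (Suc n) g * mat_adjoint V) $$ (i, j) = (\<Sum>x<Suc n. V $$ (i, x) * g x * cnj (V $$ (j, x)))"
      using V ij by (simp add: mat_diag_mult_right index_mult_mat_sum[of _ "Suc n" "Suc n" _ "Suc n"] del: index_mult_mat sum.lessThan_Suc)
    also have "\<dots> = B $$ (i, j)"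
    proof (cases "i = 0 \<or> j = 0")
      case True
      then show ?thesis unfolding sum.lessThan_Suc_shift using ij B0 B0' e
        by (cases i; cases j) (auto simp: V_def g_def)
    next
      case False
      then obtain i' j' where [simp]: "i = Suc i'" "j = Suc j'" by (metis not0_implies_Suc)
      have "C $$ (i', j') = (\<Sum>x<n. U $$ (i', x) * f x * cnj (U $$ (j', x)))"
        using U(1) ij by (simp add: U(4) mat_diag_mult_right index_mult_mat_sum[of _ n n _ n] del: index_mult_mat)
      then show ?thesis unfolding sum.lessThan_Suc_shift using ij
        by (auto simp: V_def g_def C_def)
    qed
    finally show "B $$ (i, j) = (V * real_diag (Suc n) g * mat_adjoint V) $$ (i, j)" by simp
  qed (use V B in auto)
  note assoc = assoc_mult_mat[of _ "Suc n" "Suc n" _ "Suc n" _ "Suc n"]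
  have adj: "mat_adjoint W \<in> carrier_mat (Suc n) (Suc n)" "mat_adjoint V \<in> carrier_mat (Suc n) (Suc n)"
    "real_diag (Suc n) g \<in> carrier_mat (Suc n) (Suc n)"
    using W V by auto
  have "diagonalizes (Suc n) (W * V) g A"
    unfolding diagonalizes_def
  proof (intro conjI)
    show "W * V \<in> carrier_mat (Suc n) (Suc n)" using W V by simp
    have "mat_adjoint (W * V) * (W * V) = mat_adjoint V * (mat_adjoint W * W) * V"
      using W(1) V adj by (simp add: mat_adjoint_mult[of _ "Suc n" "Suc n" _ "Suc n"] assoc)
    then show "mat_adjoint (W * V) * (W * V) = 1\<^sub>m (Suc n)" using W V VV adj by simp
    have "W * V * real_diag (Suc n) g * mat_adjoint (W * V) = W * (V * real_diag (Suc n) g * mat_adjoint V) * mat_adjoint W"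
      using W(1) V adj by (simp add: mat_adjoint_mult[of _ "Suc n" "Suc n" _ "Suc n"] assoc)
    also have "\<dots> = (W * mat_adjoint W) * A * (W * mat_adjoint W)"
      unfolding BV[symmetric] B_def using W(1) A adj by (simp add: assoc)
    finally show "A = W * V * real_diag (Suc n) g * mat_adjoint (W * V)" using W3 A by simp
  qed
  then show ?case by (rule Suc(2))
qed

section \<open>Functional calculus\<close>

lemma unitary_cancel:
  assumes "U \<in> carrier_mat n n" "mat_adjoint U * U = 1\<^sub>m n" "X \<in> carrier_mat n n"
  shows "mat_adjoint U * (U * X) = X" "U * (mat_adjoint U * X) = X"
proof -
  have "U * mat_adjoint U = 1\<^sub>m n"
    using mat_mult_left_right_inverse[of "mat_adjoint U" n U] assms by auto
  then show "mat_adjoint U * (U * X) = X" "U * (mat_adjoint U * X) = X"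
    using assms by (simp_all add: assoc_mult_mat[symmetric, of _ n n _ n _ n])
qed

lemma unitary_right:
  assumes "U \<in> carrier_mat n n" "mat_adjoint U * U = 1\<^sub>m n"
  shows "U * mat_adjoint U = 1\<^sub>m n"
  using mat_mult_left_right_inverse[of "mat_adjoint U" n U] assms by auto

lemma conj_diag_index:
  assumes "U \<in> carrier_mat n n" "V \<in> carrier_mat n n" "i < n" "j < n"
  shows "(U * mat_diag n f * mat_adjoint V) $$ (i, j) = (\<Sum>x<n. U $$ (i, x) * f x * cnj (V $$ (j, x)))"
  using assms
  by (simp add: mat_diag_mult_right index_mult_mat_sum[of _ n n _ n] del: index_mult_mat)

text \<open>In terms of the transition matrix \<open>W\<close> between the two eigenbases, the
  operators agree iff \<open>f i = g j\<close> wherever \<open>W $$ (i, j)\<close> is nonzero. That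
  condition survives applying one function to both eigenvalue lists, which makes the functional
  calculus well defined.\<close>

lemma conj_diag_eq_iff:
  assumes U: "U \<in> carrier_mat n n" "mat_adjoint U * U = 1\<^sub>m n"
    and V: "V \<in> carrier_mat n n" "mat_adjoint V * V = 1\<^sub>m n"
  defines "W \<equiv> mat_adjoint U * V"
  shows "U * mat_diag n f * mat_adjoint U = V * mat_diag n g * mat_adjoint V \<longleftrightarrow>
    (\<forall>i<n. \<forall>j<n. f i * W $$ (i, j) = W $$ (i, j) * g j)" (is "?L \<longleftrightarrow> ?R")
proof -
  note assoc = assoc_mult_mat[of _ n n _ n _ n]
  have W: "W \<in> carrier_mat n n" using U V by (simp add: W_def)
  have eq: "?R \<longleftrightarrow> mat_diag n f * W = W * mat_diag n g"
    using W by (auto simp: mat_diag_mult_right[of _ n] mat_diag_mult_left[of _ n n] mat_eq_iff)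
  show ?thesis unfolding eq
  proof
    assume ?L
    have "mat_diag n f * W = mat_adjoint U * (U * mat_diag n f * mat_adjoint U) * V"
      using U V by (simp add: W_def assoc unitary_cancel)
    also have "\<dots> = W * mat_diag n g"
      unfolding \<open>?L\<close> using U V by (simp add: W_def assoc)
    finally show "mat_diag n f * W = W * mat_diag n g" .
  next
    assume R: "mat_diag n f * W = W * mat_diag n g"
    have "U * mat_diag n f * mat_adjoint U = U * (mat_diag n f * W) * mat_adjoint V"
      using U V by (simp add: W_def assoc unitary_cancel unitary_right)
    also have "\<dots> = V * mat_diag n g * mat_adjoint V"
      unfolding R using U V by (simp add: W_def assoc unitary_cancel)
    finally show ?L .
  qed
qed

lemma mat_fun_eq:
  assumes "diagonalizes n U e A"
  shows "mat_fun f A = U * real_diag n (\<lambda>i. f (e i)) * mat_adjoint U"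
proof -
  note U = diagonalizesD[OF assms]
  have dim: "dim_row A = n" using U(5) by simp
  show ?thesis
    unfolding mat_fun_def dim
  proof (rule some_equality)
    show "\<exists>U' e'. U' \<in> carrier_mat n n \<and> mat_adjoint U' * U' = 1\<^sub>m n \<and>
        A = U' * real_diag n e' * mat_adjoint U' \<and>
        U * real_diag n (\<lambda>i. f (e i)) * mat_adjoint U = U' * real_diag n (\<lambda>i. f (e' i)) * mat_adjoint U'"
      using U by blast
  next
    fix B assume "\<exists>U e. U \<in> carrier_mat n n \<and> mat_adjoint U * U = 1\<^sub>m n \<and>
        A = U * real_diag n e * mat_adjoint U \<and> B = U * real_diag n (\<lambda>i. f (e i)) * mat_adjoint U"
    then obtain V g where V: "V \<in> carrier_mat n n" "mat_adjoint V * V = 1\<^sub>m n"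
      and A: "A = V * real_diag n g * mat_adjoint V" and B: "B = V * real_diag n (\<lambda>i. f (g i)) * mat_adjoint V"
      by blast
    define W where "W = mat_adjoint U * V"
    have *: "\<forall>i<n. \<forall>j<n. complex_of_real (e i) * W $$ (i, j) = W $$ (i, j) * complex_of_real (g j)"
      using iffD1[OF conj_diag_eq_iff[OF U(1,2) V] trans[OF U(4)[symmetric] A]] unfolding W_def .
    \<comment> \<open>Where \<open>W\<close> is nonzero the eigenvalues \<open>e i\<close> and
      \<open>g j\<close> coincide, hence so do their images under \<open>f\<close>.\<close>
    have "complex_of_real (f (e i)) * W $$ (i, j) = W $$ (i, j) * complex_of_real (f (g j))" if "i < n" "j < n" for i j
      using *[rule_format, OF that] by (cases "W $$ (i, j) = 0") (simp_all add: mult.commute)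
    then have "\<forall>i<n. \<forall>j<n. complex_of_real (f (e i)) * W $$ (i, j) = W $$ (i, j) * complex_of_real (f (g j))"
      by blast
    from iffD2[OF conj_diag_eq_iff[OF U(1,2) V] this[unfolded W_def]] B
    show "B = U * real_diag n (\<lambda>i. f (e i)) * mat_adjoint U" by (rule trans[OF _ sym, rotated])
  qed
qed

lemma diagonalizes_mat_fun:
  assumes "diagonalizes n U e A"
  shows "diagonalizes n U (\<lambda>i. f (e i)) (mat_fun f A)"
  using diagonalizesD[OF assms] mat_fun_eq[OF assms] by (simp add: diagonalizes_def)

lemma conj_diag_linear:
  assumes "U \<in> carrier_mat n n"
  shows "U * real_diag n e * mat_adjoint U + U * real_diag n f * mat_adjoint U = U * real_diag n (\<lambda>i. e i + f i) * mat_adjoint U"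
    "complex_of_real c \<cdot>\<^sub>m (U * real_diag n e * mat_adjoint U) = U * real_diag n (\<lambda>i. c * e i) * mat_adjoint U"
  using assms
  by (auto intro!: eq_matI simp: conj_diag_index algebra_simps sum.distrib sum_distrib_left simp del: index_mult_mat(1))

lemma diagonalizes_smult:
  assumes "diagonalizes n U e A"
  shows "diagonalizes n U (\<lambda>i. c * e i) (complex_of_real c \<cdot>\<^sub>m A)"
  using assms conj_diag_linear(2)[of U n c e] unfolding diagonalizes_def by simp

lemma diagonalizes_one_shift:
  assumes "diagonalizes n U e A"
  shows "diagonalizes n U (\<lambda>i. e i + c) (A + complex_of_real c \<cdot>\<^sub>m 1\<^sub>m n)"
proof -
  note U = diagonalizesD[OF assms]
  have "complex_of_real c \<cdot>\<^sub>m 1\<^sub>m n = U * real_diag n (\<lambda>i. c * 1) * mat_adjoint U"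
    using conj_diag_linear(2)[OF U(1), of c "\<lambda>_. 1"] U by simp
  then show ?thesis using conj_diag_linear(1)[OF U(1), of e "\<lambda>_. c"] U unfolding diagonalizes_def by simp
qed

lemma mat_log2_eq:
  assumes "diagonalizes n U e A"
  shows "mat_log2 A = complex_of_real (1 / ln 2) \<cdot>\<^sub>m mat_fun ln A"
  unfolding mat_log2_def mat_fun_eq[OF assms]
  using conj_diag_linear(2)[of U n "1 / ln 2" "\<lambda>i. ln (e i)"] diagonalizesD[OF assms]
  by (simp add: log_def mult.commute)

lemma mat_pow_diagonalizes:
  assumes "diagonalizes n U e A"
  shows "A ^\<^sub>m k = U * real_diag n (\<lambda>i. e i ^ k) * mat_adjoint U"
proof (induction k)
  case 0
  then show ?case using diagonalizesD[OF assms] by simp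
next
  case (Suc k)
  note U = diagonalizesD[OF assms]
  note assoc = assoc_mult_mat[of _ n n _ n _ n]
  have "A ^\<^sub>m Suc k = (U * real_diag n (\<lambda>i. e i ^ k) * mat_adjoint U) * (U * real_diag n e * mat_adjoint U)"
    using Suc U(4) by simp
  also have "\<dots> = U * (real_diag n (\<lambda>i. e i ^ k) * real_diag n e) * mat_adjoint U"
    using U by (simp add: assoc unitary_cancel del: mat_diag_diag)
  finally show ?case by (simp add: mult.commute)
qed

lemma diagonalizes_mat_exp:
  assumes "diagonalizes n U e A"
  shows "diagonalizes n U (\<lambda>i. exp (e i)) (mat_exp A)"
proof -
  note U = diagonalizesD[OF assms]
  have "mat_exp A = U * real_diag n (\<lambda>i. exp (e i)) * mat_adjoint U"
  proof (rule eq_matI)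
    fix i j assume "i < dim_row (U * real_diag n (\<lambda>i. exp (e i)) * mat_adjoint U)"
      "j < dim_col (U * real_diag n (\<lambda>i. exp (e i)) * mat_adjoint U)"
    then have ij: "i < n" "j < n" using U by auto
    have ex: "(\<lambda>k. complex_of_real (x ^ k) / fact k) sums complex_of_real (exp x)" for x :: real
    proof -
      have "(\<lambda>k. complex_of_real (x ^ k / fact k)) sums complex_of_real (exp x)"
        using exp_converges[of x] by (intro sums_of_real) (simp add: field_simps)
      then show ?thesis by simp
    qed
    have "(\<lambda>k. \<Sum>x<n. U $$ (i, x) * (complex_of_real (e x ^ k) / fact k) * cnj (U $$ (j, x)))
        sums (\<Sum>x<n. U $$ (i, x) * complex_of_real (exp (e x)) * cnj (U $$ (j, x)))"
      by (intro sums_sum sums_mult sums_mult2 ex)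
    then have "(\<lambda>k. (A ^\<^sub>m k) $$ (i, j) / fact k) sums (\<Sum>x<n. U $$ (i, x) * complex_of_real (exp (e x)) * cnj (U $$ (j, x)))"
      unfolding mat_pow_diagonalizes[OF assms] conj_diag_index[OF U(1,1) ij] sum_divide_distrib
      by (simp add: field_simps)
    then show "mat_exp A $$ (i, j) = (U * real_diag n (\<lambda>i. exp (e i)) * mat_adjoint U) $$ (i, j)"
      unfolding conj_diag_index[OF U(1,1) ij] using U(5) ij by (simp add: mat_exp_def sums_unique[symmetric])
  qed (use U in \<open>auto simp: mat_exp_def\<close>)
  then show ?thesis using U unfolding diagonalizes_def by simp
qed

section \<open>Traces of products in eigenbases\<close>

lemma mat_trace_diagonalizes_mult:
  assumes "diagonalizes n U a A" "X \<in> carrier_mat n n"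
  shows "mat_trace (A * X) = (\<Sum>i<n. a i * (mat_adjoint U * X * U) $$ (i, i))"
proof -
  note U = diagonalizesD[OF assms(1)]
  note assoc = assoc_mult_mat[of _ n n _ n _ n]
  have "mat_trace (A * X) = mat_trace (U * (real_diag n a * mat_adjoint U * X))"
    unfolding U(4) using U assms(2) by (simp add: assoc)
  also have "\<dots> = mat_trace ((real_diag n a * mat_adjoint U * X) * U)"
    using U assms(2) by (intro mat_trace_mult_comm[of _ n n]) auto
  also have "\<dots> = mat_trace (real_diag n a * (mat_adjoint U * X * U))"
    using U assms(2) by (simp add: assoc)
  also have "\<dots> = (\<Sum>i<n. a i * (mat_adjoint U * X * U) $$ (i, i))"
    using U assms(2) by (simp add: mat_diag_mult_left[of _ n n] mat_trace_def)
  finally show ?thesis .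
qed

lemma mat_trace_diagonalizes:
  assumes "diagonalizes n U a A"
  shows "mat_trace A = (\<Sum>i<n. a i)"
proof -
  note U = diagonalizesD[OF assms]
  have "mat_trace A = mat_trace (A * 1\<^sub>m n)" using U by simp
  also have "\<dots> = (\<Sum>i<n. a i)"
    unfolding mat_trace_diagonalizes_mult[OF assms one_carrier_mat] using U by simp
  finally show ?thesis .
qed

lemma mat_trace_mult_commuting:
  assumes A: "diagonalizes n U a A" and B: "diagonalizes n U b B"
  shows "mat_trace (A * B) = (\<Sum>i<n. a i * b i)"
proof -
  note U = diagonalizesD[OF A]
  note assoc = assoc_mult_mat[of _ n n _ n _ n]
  have "A * B = U * (real_diag n a * real_diag n b) * mat_adjoint U"
    unfolding U(4) diagonalizesD(4)[OF B] using U(1,2) by (simp add: assoc unitary_cancel del: mat_diag_diag)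
  then have "diagonalizes n U (\<lambda>i. a i * b i) (A * B)"
    using U by (simp add: diagonalizes_def)
  from mat_trace_diagonalizes[OF this] show ?thesis by simp
qed

lemma mat_trace_mat_fun:
  assumes "diagonalizes n U a A"
  shows "mat_trace (A * mat_fun f A) = (\<Sum>i<n. a i * f (a i))"
  by (rule mat_trace_mult_commuting[OF assms diagonalizes_mat_fun[OF assms]])

text \<open>The transition probability \<open>|<u_i, v_j>|^2\<close> between the columns of
  \<open>U\<close> and \<open>V\<close>, a doubly stochastic matrix for unitaries. It turns traces
  of products of noncommuting operators into scalar double sums.\<close>

definition overlap :: "complex mat \<Rightarrow> complex mat \<Rightarrow> nat \<Rightarrow> nat \<Rightarrow> real" where
  "overlap U V i j = (cmod ((mat_adjoint U * V) $$ (i, j)))\<^sup>2"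

lemma overlap_nonneg [simp]: "overlap U V i j \<ge> 0"
  by (simp add: overlap_def)

lemma mult_adjoint_diag_index:
  assumes "X \<in> carrier_mat n k" "i < n"
  shows "(X * mat_adjoint X) $$ (i, i) = (\<Sum>j<k. (cmod (X $$ (i, j)))\<^sup>2)"
proof -
  have "(X * mat_adjoint X) $$ (i, i) = (\<Sum>j<k. X $$ (i, j) * mat_adjoint X $$ (j, i))"
    using assms by (intro index_mult_mat_sum) auto
  also have "\<dots> = (\<Sum>j<k. of_real ((cmod (X $$ (i, j)))\<^sup>2))"
    using assms by (intro sum.cong) (auto simp: complex_norm_square simp del: of_real_power)
  finally show ?thesis by simp
qed

lemma adjoint_mult_diag_index:
  assumes "X \<in> carrier_mat k n" "i < n"
  shows "(mat_adjoint X * X) $$ (i, i) = (\<Sum>j<k. (cmod (X $$ (j, i)))\<^sup>2)"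
proof -
  have "(mat_adjoint X * mat_adjoint (mat_adjoint X)) $$ (i, i) = (\<Sum>j<k. (cmod (mat_adjoint X $$ (i, j)))\<^sup>2)"
    using assms by (intro mult_adjoint_diag_index) auto
  also have "\<dots> = (\<Sum>j<k. (cmod (X $$ (j, i)))\<^sup>2)" using assms by (intro arg_cong[where f = complex_of_real] sum.cong) auto
  finally show ?thesis by simp
qed

lemma sum_overlap:
  assumes "U \<in> carrier_mat n n" "mat_adjoint U * U = 1\<^sub>m n" "V \<in> carrier_mat n n" "mat_adjoint V * V = 1\<^sub>m n" "i < n"
  shows "(\<Sum>j<n. overlap U V i j) = 1"
proof -
  let ?W = "mat_adjoint U * V"
  note assoc = assoc_mult_mat[of _ n n _ n _ n]
  have "mat_adjoint ?W = mat_adjoint V * U"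
    using assms by (subst mat_adjoint_mult[of _ n n _ n]) auto
  then have "?W * mat_adjoint ?W = 1\<^sub>m n" using assms by (simp add: assoc unitary_cancel)
  moreover have "(?W * mat_adjoint ?W) $$ (i, i) = complex_of_real (\<Sum>j<n. overlap U V i j)"
    unfolding overlap_def using assms by (intro mult_adjoint_diag_index) auto
  ultimately show ?thesis using assms(5) by (simp add: complex_eq_iff)
qed

lemma mat_trace_two:
  assumes A: "diagonalizes n U a A" and B: "diagonalizes n V b B"
  shows "mat_trace (A * B) = complex_of_real (\<Sum>i<n. \<Sum>j<n. overlap U V i j * (a i * b j))"
proof -
  note U = diagonalizesD[OF A] and V = diagonalizesD[OF B]
  note assoc = assoc_mult_mat[of _ n n _ n _ n]
  let ?W = "mat_adjoint U * V"
  have W: "?W \<in> carrier_mat n n" using U V by simp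
  have "mat_adjoint ?W = mat_adjoint V * U"
    using U V by (subst mat_adjoint_mult[of _ n n _ n]) auto
  then have "mat_adjoint U * B * U = ?W * real_diag n b * mat_adjoint ?W"
    unfolding V(4) using U V by (simp add: assoc)
  then have "(mat_adjoint U * B * U) $$ (i, i) = complex_of_real (\<Sum>j<n. overlap U V i j * b j)" if "i < n" for i
    using that by (simp add: conj_diag_index[OF W W] overlap_def complex_norm_square mult.commute mult.left_commute
      del: index_mult_mat of_real_power)
  then show ?thesis unfolding mat_trace_diagonalizes_mult[OF A V(5)]
    by (simp add: sum_distrib_left mult.left_commute)
qed

section \<open>Positivity\<close>

lemma mat_trace_mult_mult_adjoint:
  assumes d: "diagonalizes n U a A" and C: "C \<in> carrier_mat n n"
  shows "mat_trace (A * (C * mat_adjoint C)) =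
    complex_of_real (\<Sum>k<n. a k * (\<Sum>j<n. (cmod ((mat_adjoint U * C) $$ (k, j)))\<^sup>2))"
proof -
  note U = diagonalizesD[OF d]
  note assoc = assoc_mult_mat[of _ n n _ n _ n]
  have UC: "mat_adjoint U * C \<in> carrier_mat n n" using U(1) C by simp
  have "mat_adjoint U * (C * mat_adjoint C) * U = (mat_adjoint U * C) * mat_adjoint (mat_adjoint U * C)"
    using U(1) C by (simp add: mat_adjoint_mult[of _ n n _ n] assoc)
  then have "mat_trace (A * (C * mat_adjoint C)) =
      (\<Sum>k<n. a k * ((mat_adjoint U * C) * mat_adjoint (mat_adjoint U * C)) $$ (k, k))"
    using C by (simp add: mat_trace_diagonalizes_mult[OF d] del: index_mult_mat)
  also have "\<dots> = (\<Sum>k<n. complex_of_real (a k * (\<Sum>j<n. (cmod ((mat_adjoint U * C) $$ (k, j)))\<^sup>2)))"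
    by (intro sum.cong refl) (simp only: lessThan_iff mult_adjoint_diag_index[OF UC] of_real_mult)
  finally show ?thesis by simp
qed

text \<open>Products \<open>C * mat_adjoint C\<close> serve as test operators instead of vectors
  because \<open>embed\<close> maps them to products of the same form; this is what makes partial
  traces positive.\<close>

lemma positive_operator_iff_trace:
  assumes A: "A \<in> carrier_mat n n" "hermitian A"
  shows "positive_operator A \<longleftrightarrow> (\<forall>C\<in>carrier_mat n n. 0 \<le> Re (mat_trace (A * (C * mat_adjoint C))))"
    and "diagonalizes n U a A \<Longrightarrow> positive_operator A \<longleftrightarrow> (\<forall>i<n. 0 \<le> a i)"
proof -
  \<comment> \<open>A vector enters as the matrix with \<open>v\<close> in column 0 and zeros
    elsewhere, so that \<open>C * mat_adjoint C\<close> is the rank-one operator of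
    \<open>v\<close>.\<close>
  have quad: "Re (mat_trace (A * (C * mat_adjoint C))) = Re ((A *\<^sub>v v) \<bullet>c v)"
    if v: "v \<in> carrier_vec n" and n: "0 < n" and C: "C = mat n n (\<lambda>(i, j). if j = 0 then v $ i else 0)" for v C
  proof -
    have Cc: "C \<in> carrier_mat n n" by (simp add: C)
    have "C * mat_adjoint C = mat n n (\<lambda>(i, j). v $ i * cnj (v $ j))" 
    proof (rule eq_matI)
      fix i j assume "i < dim_row (mat n n (\<lambda>(i, j). v $ i * cnj (v $ j)))" "j < dim_col (mat n n (\<lambda>(i, j). v $ i * cnj (v $ j)))"
      then have ij: "i < n" "j < n" by auto
      have "(C * mat_adjoint C) $$ (i, j) = (\<Sum>x<n. C $$ (i, x) * mat_adjoint C $$ (x, j))"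
        using Cc ij by (intro index_mult_mat_sum) auto
      also have "\<dots> = (\<Sum>x<n. if x = 0 then v $ i * cnj (v $ j) else 0)"
        using ij by (intro sum.cong) (auto simp: C)
      finally show "(C * mat_adjoint C) $$ (i, j) = mat n n (\<lambda>(i, j). v $ i * cnj (v $ j)) $$ (i, j)"
        using ij n by simp
    qed (auto simp: C)
    then have "mat_trace (A * (C * mat_adjoint C)) = (\<Sum>i<n. \<Sum>j<n. A $$ (i, j) * (v $ j * cnj (v $ i)))"
      using A by (simp add: mat_trace_mult)
    also have "\<dots> = (A *\<^sub>v v) \<bullet>c v"
      using A v by (simp add: scalar_prod_def sum_distrib_right atLeast0LessThan mult.assoc)
    finally show ?thesis by simp
  qed
  have pos1: "0 \<le> a i" if d: "diagonalizes n U a A" and "positive_operator A" "i < n" for U a i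
  proof -
    note U = diagonalizesD[OF d]
    note assoc = assoc_mult_mat[of _ n n _ n _ n]
    define C :: "complex mat" where "C = mat n n (\<lambda>(k, j). if j = 0 then col U i $ k else 0)"
    have Cc: "C \<in> carrier_mat n n" by (simp add: C_def)
    have UC: "(mat_adjoint U * C) $$ (k, j) = (if k = i \<and> j = 0 then 1 else 0)" if "k < n" "j < n" for k j
    proof -
      have "(mat_adjoint U * C) $$ (k, j) = (\<Sum>x<n. mat_adjoint U $$ (k, x) * C $$ (x, j))"
        using U Cc that by (intro index_mult_mat_sum) auto
      also have "\<dots> = (if j = 0 then (\<Sum>x<n. mat_adjoint U $$ (k, x) * U $$ (x, i)) else 0)"
        using that U(1) \<open>i < n\<close> by (auto simp: C_def)
      also have "(\<Sum>x<n. mat_adjoint U $$ (k, x) * U $$ (x, i)) = (mat_adjoint U * U) $$ (k, i)"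
        using U that \<open>i < n\<close> by (intro index_mult_mat_sum[symmetric]) auto
      finally show ?thesis using that \<open>i < n\<close> U(2) by auto
    qed
    have "mat_trace (A * (C * mat_adjoint C)) = (\<Sum>k<n. complex_of_real (a k) * complex_of_real (\<Sum>j<n. (cmod ((mat_adjoint U * C) $$ (k, j)))\<^sup>2))"
      unfolding mat_trace_mult_mult_adjoint[OF d Cc] by simp
    also have "\<dots> = (\<Sum>k<n. if k = i then complex_of_real (a k) else 0)"
    proof (intro sum.cong refl)
      fix k assume k: "k \<in> {..<n}"
      have "(\<Sum>j<n. (cmod ((mat_adjoint U * C) $$ (k, j)))\<^sup>2) = (\<Sum>j<n. if j = 0 then (if k = i then 1 else 0) else 0)"
        using k by (intro sum.cong) (auto simp: UC simp del: index_mult_mat)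
      also have "\<dots> = (if k = i then 1 else 0)" using k by simp
      finally show "complex_of_real (a k) * complex_of_real (\<Sum>j<n. (cmod ((mat_adjoint U * C) $$ (k, j)))\<^sup>2) = (if k = i then complex_of_real (a k) else 0)"
        by simp
    qed
    finally have "Re (mat_trace (A * (C * mat_adjoint C))) = a i" using \<open>i < n\<close> by simp
    moreover have "Re (mat_trace (A * (C * mat_adjoint C))) = Re ((A *\<^sub>v col U i) \<bullet>c col U i)"
      using U(1) \<open>i < n\<close> by (intro quad) (auto simp: C_def)
    moreover have "col U i \<in> carrier_vec (dim_row A)" using U(1) A \<open>i < n\<close> by auto
    ultimately show ?thesis using \<open>positive_operator A\<close> unfolding positive_operator_def by metis
  qed
  have pos2: "0 \<le> Re (mat_trace (A * (C * mat_adjoint C)))"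
    if d: "diagonalizes n U a A" and a: "\<forall>i<n. 0 \<le> a i" and Cc: "C \<in> carrier_mat n n" for U a C
  proof -
    note U = diagonalizesD[OF d]
    note assoc = assoc_mult_mat[of _ n n _ n _ n]
    show ?thesis unfolding mat_trace_mult_mult_adjoint[OF d Cc] using a
      by (auto intro!: sum_nonneg mult_nonneg_nonneg simp del: of_real_sum of_real_mult)
  qed
  have pos3: "positive_operator A" if "\<forall>C\<in>carrier_mat n n. 0 \<le> Re (mat_trace (A * (C * mat_adjoint C)))"
    unfolding positive_operator_def
  proof (intro conjI ballI)
    fix v :: "complex vec" assume "v \<in> carrier_vec (dim_row A)"
    then have v: "v \<in> carrier_vec n" using A by simp
    show "0 \<le> Re ((A *\<^sub>v v) \<bullet>c v)"
    proof (cases "n = 0")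
      case True
      then show ?thesis using v by (simp add: scalar_prod_def)
    next
      case False
      with quad[OF v _ refl] that show ?thesis by (metis (no_types, lifting) mat_carrier neq0_conv)
    qed
  qed (rule A)
  obtain V b where Vb: "diagonalizes n V b A" using hermitian_diagonalizes[OF A] .
  show "positive_operator A \<longleftrightarrow> (\<forall>C\<in>carrier_mat n n. 0 \<le> Re (mat_trace (A * (C * mat_adjoint C))))"
    using pos1[OF Vb] pos2[OF Vb] pos3 by blast
  show "positive_operator A \<longleftrightarrow> (\<forall>i<n. 0 \<le> a i)" if "diagonalizes n U a A"
    using pos1[OF that] pos2[OF that] pos3 by blast
qed

section \<open>Monotonicity of the relative entropy\<close>

text \<open>For positive \<open>A = \<Sum> a\<^sub>i |u\<^sub>i\<rangle>\<langle>u\<^sub>i|\<close> and \<open>B = \<Sum> b\<^sub>j |v\<^sub>j\<rangle>\<langle>v\<^sub>j|\<close>, the sum below is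
  \<open>Tr A (L\<^sub>B + t R\<^sub>A)\<^sup>-\<^sup>1 A\<close> with \<open>L\<^sub>B\<close>, \<open>R\<^sub>A\<close> the left and right multiplications. It is the supremum over
  \<open>X\<close> of a function that is affine in \<open>(A, B)\<close>, which makes it monotone under restriction to a
  subalgebra, and it is the \<open>t\<close>-derivative of an interpolation between \<open>Tr A ln B\<close> and
  \<open>Tr A ln A\<close>.\<close>

definition resolvent_sum ::
    "nat \<Rightarrow> complex mat \<Rightarrow> (nat \<Rightarrow> real) \<Rightarrow> complex mat \<Rightarrow> (nat \<Rightarrow> real) \<Rightarrow> real \<Rightarrow> real" where
  "resolvent_sum n U a V b t = (\<Sum>i<n. \<Sum>j<n. overlap U V i j * ((a i)\<^sup>2 / (b j + t * a i)))"

text \<open>The last two terms are the quadratic form of \<open>L_B + t R_A\<close> at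
  \<open>X\<close>, and the first is linear in \<open>X\<close>; completing the square makes the
  supremum \<open>Tr A (L_B + t R_A)^(-1) A\<close>.\<close>

definition variational :: "complex mat \<Rightarrow> complex mat \<Rightarrow> real \<Rightarrow> complex mat \<Rightarrow> real" where
  "variational A B t X = 2 * Re (mat_trace (A * X)) - Re (mat_trace (B * (X * mat_adjoint X)))
     - t * Re (mat_trace (A * (mat_adjoint X * X)))"

text \<open>The operators \<open>|v_j><u_i|\<close> are eigenvectors of \<open>L_B + t R_A\<close>
  with eigenvalues \<open>b j + t * a i\<close>. In these coordinates the form decouples into one
  scalar quadratic for each pair \<open>(i, j)\<close>.\<close>

lemma variational_eq:
  assumes A: "diagonalizes n U a A" and B: "diagonalizes n V b B" and X: "X \<in> carrier_mat n n"
  defines "x \<equiv> mat_adjoint V * X * U"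
  shows "variational A B t X = (\<Sum>i<n. \<Sum>j<n.
     2 * a i * Re ((mat_adjoint U * V) $$ (i, j) * x $$ (j, i)) - (b j + t * a i) * (cmod (x $$ (j, i)))\<^sup>2)"
proof -
  note U = diagonalizesD(1-3)[OF A] and V = diagonalizesD(1-3)[OF B]
  note assoc = assoc_mult_mat[of _ n n _ n _ n]
  let ?W = "mat_adjoint U * V"
  have W: "?W \<in> carrier_mat n n" and x: "x \<in> carrier_mat n n" using U V X by (simp_all add: x_def)
  have adjx: "mat_adjoint x = mat_adjoint U * mat_adjoint X * V"
    using U V X by (simp add: x_def mat_adjoint_mult[of _ n n _ n] assoc)
  have 1: "mat_adjoint U * X * U = ?W * x"
    using U V X by (simp add: x_def assoc unitary_cancel)
  have 2: "mat_adjoint V * (X * mat_adjoint X) * V = x * mat_adjoint x"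
    unfolding adjx using U V X by (simp add: x_def assoc unitary_cancel)
  have 3: "mat_adjoint U * (mat_adjoint X * X) * U = mat_adjoint x * x"
    unfolding adjx using U V X by (simp add: x_def assoc unitary_cancel)
  have t1: "Re (mat_trace (A * X)) = (\<Sum>i<n. \<Sum>j<n. a i * Re (?W $$ (i, j) * x $$ (j, i)))"
    unfolding mat_trace_diagonalizes_mult[OF A X] 1
    by (simp add: index_mult_mat_sum[OF W x] sum_distrib_left del: index_mult_mat)
  have t2: "Re (mat_trace (B * (X * mat_adjoint X))) = (\<Sum>i<n. \<Sum>j<n. b j * (cmod (x $$ (j, i)))\<^sup>2)"
    using X unfolding mat_trace_diagonalizes_mult[OF B mult_square_carrier[OF X mat_adjoint_carrier[OF X]]] 2
    by (subst sum.swap) (simp add: mult_adjoint_diag_index[OF x] sum_distrib_left del: index_mult_mat of_real_sum of_real_power)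
  have t3: "Re (mat_trace (A * (mat_adjoint X * X))) = (\<Sum>i<n. \<Sum>j<n. a i * (cmod (x $$ (j, i)))\<^sup>2)"
    using X unfolding mat_trace_diagonalizes_mult[OF A mult_square_carrier[OF mat_adjoint_carrier[OF X] X]] 3
    by (simp add: adjoint_mult_diag_index[OF x] sum_distrib_left del: index_mult_mat of_real_sum of_real_power)
  show ?thesis unfolding variational_def t1 t2 t3
    by (simp add: sum_distrib_left sum_subtractf sum.distrib algebra_simps)
qed

lemma variational_le_resolvent_sum:
  assumes A: "diagonalizes n U a A" "\<And>i. i < n \<Longrightarrow> 0 \<le> a i"
    and B: "diagonalizes n V b B" "\<And>i. i < n \<Longrightarrow> 0 < b i" and X: "X \<in> carrier_mat n n" and t: "0 \<le> t"
  shows "variational A B t X \<le> resolvent_sum n U a V b t"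
  unfolding variational_eq[OF A(1) B(1) X] resolvent_sum_def
proof (intro sum_mono)
  fix i j assume "i \<in> {..<n}" "j \<in> {..<n}"
  then have ij: "i < n" "j < n" by auto
  define w where "w = (mat_adjoint U * V) $$ (i, j)"
  define y where "y = (mat_adjoint V * X * U) $$ (j, i)"
  define c where "c = b j + t * a i"
  have c: "c > 0" unfolding c_def using A(2) B(2) ij t by (intro add_pos_nonneg mult_nonneg_nonneg) auto
  have "Re (w * y) \<le> cmod w * cmod y" using complex_Re_le_cmod[of "w * y"] by (simp add: norm_mult)
  then have "2 * a i * Re (w * y) \<le> 2 * a i * (cmod w * cmod y)"
    using A(2)[OF ij(1)] by (intro mult_left_mono) auto
  moreover have "2 * a i * (cmod w * cmod y) - c * (cmod y)\<^sup>2 \<le> (cmod w)\<^sup>2 * ((a i)\<^sup>2 / c)"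
  proof -
    \<comment> \<open>Completing the square in the modulus of a single coordinate.\<close>
    have "0 \<le> (c * cmod y - a i * cmod w)\<^sup>2 / c" using c by simp
    also have "\<dots> = (cmod w)\<^sup>2 * ((a i)\<^sup>2 / c) - (2 * a i * (cmod w * cmod y) - c * (cmod y)\<^sup>2)"
      using c by (simp add: power2_eq_square field_simps)
    finally show ?thesis by simp
  qed
  ultimately show "2 * a i * Re ((mat_adjoint U * V) $$ (i, j) * (mat_adjoint V * X * U) $$ (j, i))
      - (b j + t * a i) * (cmod ((mat_adjoint V * X * U) $$ (j, i)))\<^sup>2
      \<le> overlap U V i j * ((a i)\<^sup>2 / (b j + t * a i))"
    unfolding overlap_def w_def[symmetric] y_def[symmetric] c_def[symmetric] by linarith
qed

lemma variational_attains_resolvent_sum: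
  assumes A: "diagonalizes n U a A" "\<And>i. i < n \<Longrightarrow> 0 \<le> a i"
    and B: "diagonalizes n V b B" "\<And>i. i < n \<Longrightarrow> 0 < b i" and t: "0 \<le> t"
  obtains X where "X \<in> carrier_mat n n" "variational A B t X = resolvent_sum n U a V b t"
proof -
  note U = diagonalizesD(1-3)[OF A(1)] and V = diagonalizesD(1-3)[OF B(1)]
  note assoc = assoc_mult_mat[of _ n n _ n _ n]
  \<comment> \<open>Each entry is the maximiser of its scalar quadratic; \<open>X\<close> is this
    matrix rotated back to the original basis.\<close>
  define x where "x = mat n n (\<lambda>(j, i). a i / (b j + t * a i) * cnj ((mat_adjoint U * V) $$ (i, j)))"
  have x: "x \<in> carrier_mat n n" by (simp add: x_def)
  define X where "X = V * x * mat_adjoint U"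
  have X: "X \<in> carrier_mat n n" using U V x by (simp add: X_def)
  have xX: "mat_adjoint V * X * U = x"
    using U V x by (simp add: X_def assoc unitary_cancel)
  have "variational A B t X = resolvent_sum n U a V b t"
    unfolding variational_eq[OF A(1) B(1) X] resolvent_sum_def xX
  proof (intro sum.cong refl)
    fix i j assume "i \<in> {..<n}" "j \<in> {..<n}"
    then have ij: "i < n" "j < n" by auto
    define w where "w = (mat_adjoint U * V) $$ (i, j)"
    define c where "c = b j + t * a i"
    have c: "c > 0" unfolding c_def using A(2) B(2) ij t by (intro add_pos_nonneg mult_nonneg_nonneg) auto
    have xji: "x $$ (j, i) = complex_of_real (a i / c) * cnj w" using ij by (simp add: x_def w_def c_def)
    have "w * x $$ (j, i) = complex_of_real (a i / c * (cmod w)\<^sup>2)"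
      unfolding xji of_real_mult complex_norm_square by (simp add: mult_ac)
    then have "Re (w * x $$ (j, i)) = a i / c * (cmod w)\<^sup>2" by (simp only: Re_complex_of_real)
    moreover have "(cmod (x $$ (j, i)))\<^sup>2 = (a i / c)\<^sup>2 * (cmod w)\<^sup>2"
      unfolding xji norm_mult norm_of_real complex_mod_cnj power_mult_distrib power2_abs ..
    moreover have alg: "2 * u * (u / c * v) - c * ((u / c)\<^sup>2 * v) = v * (u\<^sup>2 / c)" for u v :: real
      using c by (simp add: power2_eq_square)
    ultimately show "2 * a i * Re ((mat_adjoint U * V) $$ (i, j) * x $$ (j, i)) - (b j + t * a i) * (cmod (x $$ (j, i)))\<^sup>2
        = overlap U V i j * ((a i)\<^sup>2 / (b j + t * a i))"
      unfolding overlap_def w_def[symmetric] c_def[symmetric]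
      using alg[of "a i" "(cmod w)\<^sup>2"] by simp
  qed
  with X show ?thesis by (rule that)
qed

lemma entropy_interpolation_deriv:
  assumes "\<And>i. i < n \<Longrightarrow> (0::real) \<le> a i" "\<And>i. i < n \<Longrightarrow> 0 < b i" "0 \<le> t"
  shows "((\<lambda>t. \<Sum>i<n. \<Sum>j<n. overlap U V i j * (a i * ln (b j + t * a i)))
    has_real_derivative resolvent_sum n U a V b t) (at t)"
  unfolding resolvent_sum_def
proof (intro DERIV_sum DERIV_cmult)
  fix i j assume "i \<in> {..<n}" "j \<in> {..<n}"
  then have "b j + t * a i > 0" using assms by (intro add_pos_nonneg mult_nonneg_nonneg) auto
  then show "((\<lambda>t. a i * ln (b j + t * a i)) has_real_derivative (a i)\<^sup>2 / (b j + t * a i)) (at t)"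
    by (auto intro!: derivative_eq_intros simp: power2_eq_square)
qed

text \<open>After subtraction of \<open>a i * ln t\<close> each summand is
  \<open>a i * ln (b j / t + a i)\<close>, so \<open>B\<close> disappears in the limit; summands
  with \<open>a i = 0\<close> vanish throughout. The correction depends on \<open>A\<close> through
  its trace only.\<close>

lemma entropy_interpolation_limit:
  assumes A: "diagonalizes n U a A" "\<And>i. i < n \<Longrightarrow> 0 \<le> a i"
    and B: "diagonalizes n V b B" "\<And>i. i < n \<Longrightarrow> 0 < b i"
  shows "((\<lambda>t. (\<Sum>i<n. \<Sum>j<n. overlap U V i j * (a i * ln (b j + t * a i))) - Re (mat_trace A) * ln t)
    \<longlongrightarrow> Re (mat_trace (A * mat_fun ln A))) at_top"
proof -
  note U = diagonalizesD(1,2)[OF A(1)] and V = diagonalizesD(1,2)[OF B(1)]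
  have lim: "((\<lambda>t. overlap U V i j * (a i * ln (b j + t * a i) - a i * ln t)) \<longlongrightarrow> overlap U V i j * (a i * ln (a i))) at_top"
    if "i < n" "j < n" for i j
  proof (cases "a i = 0")
    case False
    then have pos: "a i > 0" "b j > 0" using A(2)[OF that(1)] B(2)[OF that(2)] by auto
    have "((\<lambda>t. b j / t + a i) \<longlongrightarrow> 0 + a i) at_top"
      by (intro tendsto_add tendsto_divide_0[OF tendsto_const] tendsto_const)
        (simp add: filterlim_at_top_imp_at_infinity[OF filterlim_ident])
    then have "((\<lambda>t. a i * ln (b j / t + a i)) \<longlongrightarrow> a i * ln (a i)) at_top"
      using pos by (intro tendsto_mult tendsto_ln tendsto_const) auto
    moreover have "\<forall>\<^sub>F t in at_top. a i * ln (b j / t + a i) = a i * ln (b j + t * a i) - a i * ln t"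
      using eventually_gt_at_top[of 0]
    proof eventually_elim
      case (elim t)
      have "b j / t + a i = (b j + t * a i) / t" using elim by (simp add: field_simps)
      moreover have "b j + t * a i > 0" using pos elim by (simp add: add_pos_pos)
      ultimately show ?case using elim by (simp add: ln_div right_diff_distrib)
    qed
    ultimately have "((\<lambda>t. a i * ln (b j + t * a i) - a i * ln t) \<longlongrightarrow> a i * ln (a i)) at_top"
      by (rule Lim_transform_eventually)
    then show ?thesis by (intro tendsto_mult tendsto_const)
  qed simp
  have sum: "(\<Sum>i<n. \<Sum>j<n. overlap U V i j * f i) = (\<Sum>i<n. f i)" for f :: "nat \<Rightarrow> real"
    by (intro sum.cong refl) (simp add: sum_distrib_right[symmetric] sum_overlap[OF U V])
  have "((\<lambda>t. \<Sum>i<n. \<Sum>j<n. overlap U V i j * (a i * ln (b j + t * a i) - a i * ln t)) \<longlongrightarrow>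
      (\<Sum>i<n. \<Sum>j<n. overlap U V i j * (a i * ln (a i)))) at_top"
    by (intro tendsto_sum lim) auto
  moreover have "(\<Sum>i<n. \<Sum>j<n. overlap U V i j * (a i * ln (b j + t * a i) - a i * ln t)) =
      (\<Sum>i<n. \<Sum>j<n. overlap U V i j * (a i * ln (b j + t * a i))) - Re (mat_trace A) * ln t" for t
    unfolding right_diff_distrib sum_subtractf sum mat_trace_diagonalizes[OF A(1)]
    by (simp add: sum_distrib_right)
  moreover have "(\<Sum>i<n. \<Sum>j<n. overlap U V i j * (a i * ln (a i))) = Re (mat_trace (A * mat_fun ln A))"
    unfolding sum mat_trace_mat_fun[OF A(1)] by simp
  ultimately show ?thesis by simp
qed

section \<open>Restriction along a unital *-homomorphism\<close>

context
  fixes n p :: nat and \<phi> :: "complex mat \<Rightarrow> complex mat"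
begin

text \<open>\<open>A'\<close> represents the functional \<open>Tr (A \<sqdot>)\<close> pulled back
  along \<open>\<phi>\<close>. When \<open>\<phi>\<close> tensors with an identity,
  \<open>A'\<close> is the partial trace of \<open>A\<close>; the abstract form also fits products
  \<open>1 \<otimes> \<sigma>\<close> without computing their partial traces.\<close>

definition dual :: "complex mat \<Rightarrow> complex mat \<Rightarrow> bool" where
  "dual A A' \<longleftrightarrow> A \<in> carrier_mat n n \<and> A' \<in> carrier_mat p p \<and>
    (\<forall>X\<in>carrier_mat p p. mat_trace (A * \<phi> X) = mat_trace (A' * X))"

context
  assumes hom_carrier: "X \<in> carrier_mat p p \<Longrightarrow> \<phi> X \<in> carrier_mat n n"
    and hom_mult: "X \<in> carrier_mat p p \<Longrightarrow> Y \<in> carrier_mat p p \<Longrightarrow> \<phi> (X * Y) = \<phi> X * \<phi> Y"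
    and hom_adjoint: "X \<in> carrier_mat p p \<Longrightarrow> \<phi> (mat_adjoint X) = mat_adjoint (\<phi> X)"
    and hom_one: "\<phi> (1\<^sub>m p) = 1\<^sub>m n"
begin

text \<open>Since \<open>\<phi>\<close> respects products and adjoints, all three test operators
  \<open>X\<close>, \<open>X * mat_adjoint X\<close> and \<open>mat_adjoint X * X\<close> lie in its
  image, where \<open>A\<close> and \<open>A'\<close> cannot be distinguished.\<close>

lemma variational_dual:
  assumes "dual A A'" "dual B B'" "X \<in> carrier_mat p p"
  shows "variational A B t (\<phi> X) = variational A' B' t X"
  using assms unfolding variational_def dual_def
  by (simp add: hom_mult[symmetric] hom_adjoint[symmetric])

lemma trace_dual:
  assumes "dual A A'" shows "mat_trace A = mat_trace A'"
  using assms unfolding dual_def by (metis hom_one one_carrier_mat right_mult_one_mat)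

text \<open>The image under \<open>\<phi>\<close> of the optimal \<open>X\<close> for the small
  system is a trial operator for the large one.\<close>

lemma resolvent_sum_mono:
  assumes A: "diagonalizes n U a A" "\<And>i. i < n \<Longrightarrow> 0 \<le> a i"
    and B: "diagonalizes n V b B" "\<And>i. i < n \<Longrightarrow> 0 < b i"
    and A': "diagonalizes p U' a' A'" "\<And>i. i < p \<Longrightarrow> 0 \<le> a' i"
    and B': "diagonalizes p V' b' B'" "\<And>i. i < p \<Longrightarrow> 0 < b' i"
    and "dual A A'" "dual B B'" and t: "0 \<le> t"
  shows "resolvent_sum p U' a' V' b' t \<le> resolvent_sum n U a V b t"
proof -
  obtain X where X: "X \<in> carrier_mat p p" "variational A' B' t X = resolvent_sum p U' a' V' b' t"
    using variational_attains_resolvent_sum[OF A' B' t] by blast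
  then show ?thesis
    using variational_le_resolvent_sum[OF A B hom_carrier t, of X] variational_dual[OF assms(9,10) X(1)] by simp
qed

text \<open>By comparison of derivatives \<open>F - F'\<close> is nondecreasing on
  \<open>t \<ge> 0\<close>. Its value at 0 is the difference of the terms \<open>Tr A ln B\<close>,
  and its limit at infinity is the difference of the terms \<open>Tr A ln A\<close>.\<close>

theorem relative_entropy_mono:
  assumes A: "diagonalizes n U a A" "\<And>i. i < n \<Longrightarrow> 0 \<le> a i"
    and B: "diagonalizes n V b B" "\<And>i. i < n \<Longrightarrow> 0 < b i"
    and A': "diagonalizes p U' a' A'" "\<And>i. i < p \<Longrightarrow> 0 \<le> a' i"
    and B': "diagonalizes p V' b' B'" "\<And>i. i < p \<Longrightarrow> 0 < b' i"
    and dual: "dual A A'" "dual B B'"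
  shows "Re (mat_trace (A' * mat_fun ln A')) - Re (mat_trace (A' * mat_fun ln B'))
    \<le> Re (mat_trace (A * mat_fun ln A)) - Re (mat_trace (A * mat_fun ln B))"
proof -
  define F where "F t = (\<Sum>i<n. \<Sum>j<n. overlap U V i j * (a i * ln (b j + t * a i)))" for t
  define F' where "F' t = (\<Sum>i<p. \<Sum>j<p. overlap U' V' i j * (a' i * ln (b' j + t * a' i)))" for t
  have F0: "F 0 = Re (mat_trace (A * mat_fun ln B))" "F' 0 = Re (mat_trace (A' * mat_fun ln B'))"
    unfolding F_def F'_def mat_trace_two[OF A(1) diagonalizes_mat_fun[OF B(1)]]
      mat_trace_two[OF A'(1) diagonalizes_mat_fun[OF B'(1)]] by simp_all
  have mono: "F 0 - F' 0 \<le> F t - F' t" if "0 \<le> t" for t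
  proof (rule DERIV_nonneg_imp_nondecreasing[OF that])
    fix s :: real assume s: "0 \<le> s" "s \<le> t"
    have "((\<lambda>t. F t - F' t) has_real_derivative resolvent_sum n U a V b s - resolvent_sum p U' a' V' b' s) (at s)"
      unfolding F_def F'_def
      by (intro DERIV_diff entropy_interpolation_deriv A B A' B' s) auto
    moreover have "0 \<le> resolvent_sum n U a V b s - resolvent_sum p U' a' V' b' s"
      using resolvent_sum_mono[OF A B A' B' dual s(1)] by simp
    ultimately show "\<exists>y. ((\<lambda>t. F t - F' t) has_real_derivative y) (at s) \<and> 0 \<le> y" by blast
  qed
  have "((\<lambda>t. (F t - Re (mat_trace A) * ln t) - (F' t - Re (mat_trace A') * ln t)) \<longlongrightarrow>
      Re (mat_trace (A * mat_fun ln A)) - Re (mat_trace (A' * mat_fun ln A'))) at_top"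
    unfolding F_def F'_def
    by (intro tendsto_diff entropy_interpolation_limit[OF A B] entropy_interpolation_limit[OF A' B'])
  \<comment> \<open>\<open>A\<close> and \<open>A'\<close> have the same trace, so the two divergent
    multiples of \<open>ln t\<close> cancel.\<close>
  then have "((\<lambda>t. F t - F' t) \<longlongrightarrow> Re (mat_trace (A * mat_fun ln A)) - Re (mat_trace (A' * mat_fun ln A'))) at_top"
    unfolding trace_dual[OF dual(1)] by simp
  then have "F 0 - F' 0 \<le> Re (mat_trace (A * mat_fun ln A)) - Re (mat_trace (A' * mat_fun ln A'))"
    by (rule tendsto_lowerbound) (auto intro: eventually_mono[OF eventually_ge_at_top[of 0]] mono)
  then show ?thesis unfolding F0 by linarith
qed

end

end

section \<open>Tensor factors\<close>

text \<open>The basis of a tensor product of spaces of dimensions \<open>a\<close>, \<open>b\<close>, \<open>c\<close> is numbered by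
  \<open>x + a * (i + b * z)\<close> with \<open>x < a\<close>, \<open>i < b\<close>, \<open>z < c\<close>. \<open>embed a b c\<close> sends an operator \<open>X\<close> on
  the middle factor to \<open>1 \<otimes> X \<otimes> 1\<close>, and \<open>ptrace a b c\<close> traces out the two outer factors.\<close>

definition embed :: "nat \<Rightarrow> nat \<Rightarrow> nat \<Rightarrow> complex mat \<Rightarrow> complex mat" where
  "embed a b c X = mat (a * b * c) (a * b * c) (\<lambda>(k, l).
     if k mod a = l mod a \<and> k div (a * b) = l div (a * b)
     then X $$ (k div a mod b, l div a mod b) else 0)"

definition ptrace :: "nat \<Rightarrow> nat \<Rightarrow> nat \<Rightarrow> complex mat \<Rightarrow> complex mat" where
  "ptrace a b c M = mat b b (\<lambda>(i, j). \<Sum>x<a. \<Sum>z<c. M $$ (x + a * (i + b * z), x + a * (j + b * z)))"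

section \<open>Digits of mixed-radix numbers\<close>

lemma mixed_radix_less: "x < a \<Longrightarrow> j < n \<Longrightarrow> x + a * j < a * (n :: nat)"
  using mult_le_mono2[of "Suc j" n a] by simp

lemma mixed_radix_inj:
  assumes "x < a" "x' < (a :: nat)"
  shows "x + a * u = x' + a * u' \<longleftrightarrow> x = x' \<and> u = u'"
proof
  assume *: "x + a * u = x' + a * u'"
  have "(x + a * u) mod a = (x' + a * u') mod a" "(x + a * u) div a = (x' + a * u') div a" unfolding * by simp_all
  then show "x = x' \<and> u = u'" using assms by simp
qed simp

lemma mod_less_of_less_mult: "k < a * n \<Longrightarrow> k mod a < (a :: nat)"
  by (cases "a = 0") auto

lemma div_less_of_less_mult: "k < a * n \<Longrightarrow> k div a < (n :: nat)"
  using less_mult_imp_div_less[of k n a] by (simp add: mult.commute)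

lemma sum_lessThan_mult: "(\<Sum>k<a * n. f k) = (\<Sum>x<a. \<Sum>j<n. f (x + a * j :: nat))"
  unfolding sum.cartesian_product
  by (rule sum.reindex_bij_witness[where i = "\<lambda>(x, j). x + a * j" and j = "\<lambda>k. (k mod a, k div a)"])
    (auto simp: mixed_radix_less div_less_of_less_mult intro: mod_less_of_less_mult)

lemma sum_lessThan_delta2:
  fixes a b c :: nat
  assumes "x < a" "z < c"
  shows "(\<Sum>u<a. \<Sum>v<b. \<Sum>w<c. if w = z then (if u = x then g u v w else 0) else 0) = (\<Sum>v<b. g x v z)"
  by (subst sum.swap[of _ "{..<b}" "{..<a}"]) (use assms in simp)

lemma sum_lessThan_mult3:
  "(\<Sum>k<a * b * c. f k) = (\<Sum>x<a. \<Sum>i<b. \<Sum>z<c. f (x + a * (i + b * z) :: nat))"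
  unfolding mult.assoc sum_lessThan_mult ..

lemma mixed_radix_digits:
  assumes "x < a" "i < (b :: nat)"
  shows "(x + a * (i + b * z)) mod a = x" "(x + a * (i + b * z)) div a = i + b * z"
    "(x + a * (i + b * z)) div a mod b = i" "(x + a * (i + b * z)) div (a * b) = z"
  using assms by (simp_all add: div_mult2_eq)

lemma mixed_radix_split: "k = k mod a + a * (k div a mod b + b * (k div (a * b) :: nat))"
  by (simp add: div_mult2_eq)

lemma mixed_radix_bounds:
  assumes "k < a * b * (c :: nat)"
  shows "k mod a < a" "k div a mod b < b" "k div (a * b) < c"
  using assms mod_less_of_less_mult[of k a "b * c"] div_less_of_less_mult[of k a "b * c"]
    mod_less_of_less_mult[of "k div a" b c] div_less_of_less_mult[of k "a * b" c]
  by (simp_all add: mult.assoc)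

lemma embed_carrier: "N = a * b * c \<Longrightarrow> embed a b c X \<in> carrier_mat N N"
  by (simp add: embed_def)

lemma embed_dims [simp]: "dim_row (embed a b c X) = a * b * c" "dim_col (embed a b c X) = a * b * c"
  by (simp_all add: embed_def)

lemma ptrace_carrier [simp]: "ptrace a b c M \<in> carrier_mat b b"
  by (simp add: ptrace_def)

lemma ptrace_dims [simp]: "dim_row (ptrace a b c M) = b" "dim_col (ptrace a b c M) = b"
  by (simp_all add: ptrace_def)

lemma embed_index:
  assumes "x < a" "i < b" "z < c" "x' < a" "i' < b" "z' < c"
  shows "embed a b c X $$ (x + a * (i + b * z), x' + a * (i' + b * z')) =
    (if x = x' \<and> z = z' then X $$ (i, i') else 0)"
proof -
  have "x + a * (i + b * z) < a * b * c" "x' + a * (i' + b * z') < a * b * c"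
    unfolding mult.assoc using assms by (auto intro!: mixed_radix_less)
  then show ?thesis using assms by (simp add: embed_def mixed_radix_digits)
qed

lemma mixed_radix_cases:
  assumes "k < a * b * (c :: nat)"
  obtains x i z where "x < a" "i < b" "z < c" "k = x + a * (i + b * z)"
  using mixed_radix_bounds[OF assms] mixed_radix_split[of k a b] that by metis

lemma embed_eqI:
  assumes "M \<in> carrier_mat (a * b * c) (a * b * c)"
    and "\<And>x i z x' i' z'. x < a \<Longrightarrow> i < b \<Longrightarrow> z < c \<Longrightarrow> x' < a \<Longrightarrow> i' < b \<Longrightarrow> z' < c \<Longrightarrow>
      M $$ (x + a * (i + b * z), x' + a * (i' + b * z')) = (if x = x' \<and> z = z' then X $$ (i, i') else 0)"
  shows "M = embed a b c X"
proof (rule eq_matI)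
  fix k l assume "k < dim_row (embed a b c X)" "l < dim_col (embed a b c X)"
  then have kl: "k < a * b * c" "l < a * b * c" by auto
  obtain x i z where k: "x < a" "i < b" "z < c" "k = x + a * (i + b * z)" using mixed_radix_cases[OF kl(1)] .
  obtain x' i' z' where l: "x' < a" "i' < b" "z' < c" "l = x' + a * (i' + b * z')" using mixed_radix_cases[OF kl(2)] .
  show "M $$ (k, l) = embed a b c X $$ (k, l)"
    unfolding k(4) l(4) using k l by (simp add: assms(2) embed_index)
qed (use assms in auto)

lemma embed_add:
  assumes "X \<in> carrier_mat b b" "Y \<in> carrier_mat b b"
  shows "embed a b c (X + Y) = embed a b c X + embed a b c Y"
  by (rule eq_matI) (use assms mixed_radix_bounds(2)[of _ a b c] in \<open>auto simp: embed_def\<close>)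

lemma embed_adjoint:
  assumes "X \<in> carrier_mat b b"
  shows "embed a b c (mat_adjoint X) = mat_adjoint (embed a b c X)"
  by (rule eq_matI) (use assms mixed_radix_bounds(2)[of _ a b c] in \<open>auto simp: embed_def\<close>)

lemma embed_zero: "embed a b c (0\<^sub>m b b) = 0\<^sub>m (a * b * c) (a * b * c)"
  by (rule eq_matI) (use mixed_radix_bounds(2)[of _ a b c] in \<open>auto simp: embed_def\<close>)

lemma embed_mat_diag: "embed a b c (mat_diag b f) = mat_diag (a * b * c) (\<lambda>k. f (k div a mod b))"
proof (rule embed_eqI[symmetric])
  fix x i z x' i' z' assume *: "x < a" "i < b" "z < c" "x' < a" "i' < b" "z' < c"
  then have kl: "x + a * (i + b * z) < a * b * c" "x' + a * (i' + b * z') < a * b * c"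
    unfolding mult.assoc by (auto intro!: mixed_radix_less)
  have "x + a * (i + b * z) = x' + a * (i' + b * z') \<longleftrightarrow> x = x' \<and> i = i' \<and> z = z'"
    using * by (auto simp: mixed_radix_inj)
  then show "mat_diag (a * b * c) (\<lambda>k. f (k div a mod b)) $$ (x + a * (i + b * z), x' + a * (i' + b * z')) =
    (if x = x' \<and> z = z' then mat_diag b f $$ (i, i') else 0)"
    using * kl mixed_radix_digits[OF *(1,2), of z] by (simp add: mat_diag_def)
qed simp

lemma embed_one: "embed a b c (1\<^sub>m b) = 1\<^sub>m (a * b * c)"
  using embed_mat_diag[of a b c "\<lambda>_. 1"] by simp

lemma embed_mult:
  assumes "X \<in> carrier_mat b b" "Y \<in> carrier_mat b b"
  shows "embed a b c (X * Y) = embed a b c X * embed a b c Y"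
proof (rule embed_eqI[symmetric])
  let ?N = "a * b * c"
  show "embed a b c X * embed a b c Y \<in> carrier_mat ?N ?N" by (intro mult_square_carrier embed_carrier refl)
  fix x i z x' i' z' assume *: "x < a" "i < b" "z < c" "x' < a" "i' < b" "z' < c"
  then have kl: "x + a * (i + b * z) < a * b * c" "x' + a * (i' + b * z') < a * b * c"
    unfolding mult.assoc by (auto intro!: mixed_radix_less)
  have "(embed a b c X * embed a b c Y) $$ (x + a * (i + b * z), x' + a * (i' + b * z')) =
      (\<Sum>k<?N. embed a b c X $$ (x + a * (i + b * z), k) * embed a b c Y $$ (k, x' + a * (i' + b * z')))"
    by (rule index_mult_mat_sum[OF _ _ kl]) (simp_all add: embed_carrier)
  also have "\<dots> = (\<Sum>u<a. \<Sum>v<b. \<Sum>w<c. if w = z then (if u = x then (if x = x' \<and> z = z' then X $$ (i, v) * Y $$ (v, i') else 0) else 0) else 0)"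
    unfolding sum_lessThan_mult3 using * by (intro sum.cong refl) (auto simp: embed_index)
  also have "\<dots> = (if x = x' \<and> z = z' then (\<Sum>v<b. X $$ (i, v) * Y $$ (v, i')) else 0)"
    unfolding sum_lessThan_delta2[OF *(1,3)] by (cases "x = x'"; cases "z = z'") simp_all
  also have "\<dots> = (if x = x' \<and> z = z' then (X * Y) $$ (i, i') else 0)"
    using index_mult_mat_sum[OF assms *(2,5)] by simp
  finally show "(embed a b c X * embed a b c Y) $$ (x + a * (i + b * z), x' + a * (i' + b * z')) =
    (if x = x' \<and> z = z' then (X * Y) $$ (i, i') else 0)" .
qed

lemma diagonalizes_embed:
  assumes "diagonalizes b U e A"
  shows "diagonalizes (a * b * c) (embed a b c U) (\<lambda>k. e (k div a mod b)) (embed a b c A)"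
proof -
  note U = diagonalizesD[OF assms]
  have "embed a b c A = embed a b c U * embed a b c (real_diag b e) * embed a b c (mat_adjoint U)"
    using U by (simp add: embed_mult[symmetric])
  moreover have "embed a b c (mat_adjoint U) * embed a b c U = 1\<^sub>m (a * b * c)"
    using U by (simp add: embed_mult[symmetric] embed_one)
  ultimately show ?thesis
    using U unfolding diagonalizes_def by (simp add: embed_carrier embed_adjoint embed_mat_diag)
qed

lemma mat_fun_embed:
  assumes "diagonalizes b U e A"
  shows "mat_fun f (embed a b c A) = embed a b c (mat_fun f A)"
  using diagonalizesD(4)[OF diagonalizes_embed[OF diagonalizes_mat_fun[OF assms]]]
  by (simp add: mat_fun_eq[OF diagonalizes_embed[OF assms]])

text \<open>The deltas in \<open>embed\<close> identify the outer indices of the two factors, which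
  is tracing them out. Partial traces are mostly handled through this duality.\<close>

lemma mat_trace_mult_embed:
  assumes N: "N = a * b * c" and M: "M \<in> carrier_mat N N" and X: "X \<in> carrier_mat b b"
  shows "mat_trace (M * embed a b c X) = mat_trace (ptrace a b c M * X)"
proof -
  have "mat_trace (M * embed a b c X) = (\<Sum>k<a*b*c. \<Sum>l<a*b*c. M $$ (k, l) * embed a b c X $$ (l, k))"
    using M unfolding N by (intro mat_trace_mult embed_carrier) auto
  also have "\<dots> = (\<Sum>x<a. \<Sum>i<b. \<Sum>z<c. \<Sum>u<a. \<Sum>v<b. \<Sum>w<c.
      if w = z then (if u = x then M $$ (x + a * (i + b * z), u + a * (v + b * w)) * X $$ (v, i) else 0) else 0)"
    unfolding sum_lessThan_mult3 by (intro sum.cong refl) (auto simp: embed_index)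
  also have "\<dots> = (\<Sum>x<a. \<Sum>i<b. \<Sum>z<c. \<Sum>v<b. M $$ (x + a * (i + b * z), x + a * (v + b * z)) * X $$ (v, i))"
    by (intro sum.cong[OF refl] sum_lessThan_delta2) auto
  also have "\<dots> = (\<Sum>i<b. \<Sum>v<b. \<Sum>x<a. \<Sum>z<c. M $$ (x + a * (i + b * z), x + a * (v + b * z)) * X $$ (v, i))"
  proof -
    have swap: "(\<Sum>x<a. \<Sum>z<c. \<Sum>v<b. h x z v) = (\<Sum>v<b. \<Sum>x<a. \<Sum>z<c. h x z v)" for h :: "nat \<Rightarrow> nat \<Rightarrow> nat \<Rightarrow> complex"
      unfolding sum.swap[of _ "{..<b}" "{..<c}"] by (rule sum.swap)
    show ?thesis by (subst sum.swap) (simp only: swap)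
  qed
  also have "\<dots> = mat_trace (ptrace a b c M * X)"
    unfolding mat_trace_mult[OF ptrace_carrier X] by (simp add: ptrace_def sum_distrib_right)
  finally show ?thesis .
qed

lemma mod_mult_div: "(q mod (a * m)) div a = q div a mod (m :: nat)"
  by (cases "a = 0") (simp_all add: mod_mult2_eq)

text \<open>Nested identity factors merge. Together with the trace duality this stands in for
  composing partial traces explicitly.\<close>

lemma embed_embed:
  "embed a (a' * b' * c') c (embed a' b' c' X) = embed (a * a') b' (c' * c) X" (is "?L = ?R")
proof (rule eq_matI)
  fix k l assume "k < dim_row ?R" "l < dim_col ?R"
  then have kl: "k < a * (a' * b' * c') * c" "l < a * (a' * b' * c') * c" by (simp_all add: mult_ac)
  define k' where "k' = k div a mod (a' * b' * c')"
  define l' where "l' = l div a mod (a' * b' * c')"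
  have k'l': "k' < a' * b' * c'" "l' < a' * b' * c'"
    using mixed_radix_bounds(2)[OF kl(1)] mixed_radix_bounds(2)[OF kl(2)] by (simp_all add: k'_def l'_def)
  have digit: "(k div a mod (a' * b' * c')) div a' mod b' = k div (a * a') mod b'" for k
    by (simp add: div_mult2_eq mult.assoc mod_mult_div mod_mod_cancel)
  \<comment> \<open>The outer digits for the right-hand side are pairs, one part read from
    \<open>k\<close> and one from its middle digit; pairs agree iff both parts do.\<close>
  have low: "k mod (a * a') = a * (k div a mod (a' * b' * c') mod a') + k mod a" for k
    by (simp add: mod_mult2_eq mult.assoc)
  have high: "k div (a * (a' * b')) = c' * (k div (a * (a' * b' * c'))) + k div a mod (a' * b' * c') div (a' * b')" for k
    unfolding mod_mult_div[of _ "a' * b'" c'] by (simp add: div_mult2_eq)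
  have L: "k mod (a * a') = l mod (a * a') \<longleftrightarrow> k mod a = l mod a \<and> k' mod a' = l' mod a'"
    unfolding low[of k] low[of l] k'_def[symmetric] l'_def[symmetric]
    using mixed_radix_bounds(1)[OF kl(1)] mixed_radix_bounds(1)[OF kl(2)]
    by (auto simp: mixed_radix_inj add.commute)
  have H: "k div (a * (a' * b')) = l div (a * (a' * b')) \<longleftrightarrow>
      k div (a * (a' * b' * c')) = l div (a * (a' * b' * c')) \<and> k' div (a' * b') = l' div (a' * b')"
    unfolding high[of k] high[of l] k'_def[symmetric] l'_def[symmetric]
    using mixed_radix_bounds(3)[OF k'l'(1)] mixed_radix_bounds(3)[OF k'l'(2)]
    by (auto simp: mixed_radix_inj add.commute)
  have "k < a * a' * b' * (c' * c)" "l < a * a' * b' * (c' * c)" using kl by (simp_all add: mult_ac)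
  then have "?R $$ (k, l) = (if k mod (a * a') = l mod (a * a') \<and> k div (a * (a' * b')) = l div (a * (a' * b'))
      then X $$ (k div (a * a') mod b', l div (a * a') mod b') else 0)"
    by (simp add: embed_def mult.assoc)
  moreover have "?L $$ (k, l) = (if k mod a = l mod a \<and> k div (a * (a' * b' * c')) = l div (a * (a' * b' * c'))
      then embed a' b' c' X $$ (k', l') else 0)"
    unfolding embed_def[of a] using kl by (simp add: k'_def l'_def)
  moreover have "embed a' b' c' X $$ (k', l') = (if k' mod a' = l' mod a' \<and> k' div (a' * b') = l' div (a' * b')
      then X $$ (k' div a' mod b', l' div a' mod b') else 0)"
    unfolding embed_def using k'l' by simp
  moreover have "k' div a' mod b' = k div (a * a') mod b'" "l' div a' mod b' = l div (a * a') mod b'"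
    unfolding k'_def l'_def by (rule digit)+
  ultimately show "?L $$ (k, l) = ?R $$ (k, l)"
    by (simp only: L H split: if_split) blast
qed (simp_all add: mult_ac)

text \<open>The trace acts on the left factor and the identity is added on the right, so the two
  operations commute.\<close>

lemma ptrace_left_embed_right:
  "ptrace a (b * c) 1 (embed 1 (a * b) c X) = embed 1 b c (ptrace a b 1 X)" (is "?L = ?R")
proof (rule eq_matI)
  fix i j assume "i < dim_row ?R" "j < dim_col ?R"
  then have ij: "i < b * c" "j < b * c" by auto
  then have b: "b > 0" by (auto intro!: gr0I)
  have bij: "i mod b < b" "j mod b < b" using b by auto
  have ia: "x + a * i < a * b * c" if "x < a" "i < b * c" for x i
    using mixed_radix_less[OF that] by (simp add: mult.assoc)
  have d: "(x + a * i) div (a * b) = i div b" "(x + a * i) mod (a * b) = x + a * (i mod b)" if "x < a" for x i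
    using that by (simp_all add: div_mult2_eq mod_mult2_eq)
  show "?L $$ (i, j) = ?R $$ (i, j)"
    using ij bij by (simp add: ptrace_def embed_def ia d)
qed auto

lemma mat_trace_ptrace:
  assumes "N = a * b * c" "M \<in> carrier_mat N N"
  shows "mat_trace (ptrace a b c M) = mat_trace M"
  using mat_trace_mult_embed[OF assms one_carrier_mat] assms by (simp add: embed_one)

lemma ptrace_hermitian:
  assumes "N = a * b * c" "M \<in> carrier_mat N N" "hermitian M"
  shows "hermitian (ptrace a b c M)"
proof (rule hermitianI[OF ptrace_carrier], rule eq_matI)
  fix i j assume "i < dim_row (ptrace a b c M)" "j < dim_col (ptrace a b c M)"
  then have ij: "i < b" "j < b" by auto
  have "cnj (M $$ (x + a * (j + b * z), x + a * (i + b * z))) = M $$ (x + a * (i + b * z), x + a * (j + b * z))"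
    if "x < a" "z < c" for x z
    by (rule hermitian_index[OF assms(3,2), symmetric])
      (use that ij in \<open>auto simp: assms(1) mult.assoc intro!: mixed_radix_less\<close>)
  then show "mat_adjoint (ptrace a b c M) $$ (i, j) = ptrace a b c M $$ (i, j)"
    using ij by (simp add: ptrace_def)
qed auto

lemma ptrace_positive:
  assumes "N = a * b * c" "M \<in> carrier_mat N N" "positive_operator M"
  shows "positive_operator (ptrace a b c M)"
proof -
  have h: "hermitian M" using assms(3) by (simp add: positive_operator_def)
  show ?thesis
    unfolding positive_operator_iff_trace(1)[OF ptrace_carrier ptrace_hermitian[OF assms(1,2) h]]
  proof
    fix C :: "complex mat" assume C: "C \<in> carrier_mat b b"
    have "mat_trace (ptrace a b c M * (C * mat_adjoint C)) = mat_trace (M * (embed a b c C * mat_adjoint (embed a b c C)))"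
      using C by (simp add: mat_trace_mult_embed[OF assms(1,2), symmetric] embed_mult embed_adjoint)
    then show "0 \<le> Re (mat_trace (ptrace a b c M * (C * mat_adjoint C)))"
      using positive_operator_iff_trace(1)[OF assms(2) h] assms(3) embed_carrier[OF assms(1), of C] by simp
  qed
qed

lemma ptrace_add_smult_one:
  assumes "N = a * b * c" "M \<in> carrier_mat N N"
  shows "ptrace a b c (r \<cdot>\<^sub>m M + s \<cdot>\<^sub>m 1\<^sub>m N) = r \<cdot>\<^sub>m ptrace a b c M + (of_nat (a * c) * s) \<cdot>\<^sub>m 1\<^sub>m b"
proof (rule eq_matI)
  fix i j assume "i < dim_row (r \<cdot>\<^sub>m ptrace a b c M + (of_nat (a * c) * s) \<cdot>\<^sub>m 1\<^sub>m b)"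
    "j < dim_col (r \<cdot>\<^sub>m ptrace a b c M + (of_nat (a * c) * s) \<cdot>\<^sub>m 1\<^sub>m b)"
  then have ij: "i < b" "j < b" by auto
  have "(r \<cdot>\<^sub>m M + s \<cdot>\<^sub>m 1\<^sub>m N) $$ (x + a * (i + b * z), x + a * (j + b * z)) =
      r * M $$ (x + a * (i + b * z), x + a * (j + b * z)) + (if i = j then s else 0)" if "x < a" "z < c" for x z
  proof -
    have "x + a * (i + b * z) < N" "x + a * (j + b * z) < N"
      unfolding assms(1) mult.assoc using ij that by (auto intro!: mixed_radix_less)
    moreover have "a > 0" using that by auto
    ultimately show ?thesis using assms(2) by simp
  qed
  then show "ptrace a b c (r \<cdot>\<^sub>m M + s \<cdot>\<^sub>m 1\<^sub>m N) $$ (i, j) = (r \<cdot>\<^sub>m ptrace a b c M + (of_nat (a * c) * s) \<cdot>\<^sub>m 1\<^sub>m b) $$ (i, j)"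
    using ij by (simp add: ptrace_def sum.distrib sum_distrib_left)
qed auto

definition positive_definite :: "complex mat \<Rightarrow> bool" where
  "positive_definite A \<longleftrightarrow> (\<exists>U e. diagonalizes (dim_row A) U e A \<and> (\<forall>i<dim_row A. 0 < e i))"

text \<open>Monotonicity of the relative entropy between \<open>\<tau>\<^sub>A\<^sub>B\<^sub>C\<close> and \<open>1 \<otimes> \<sigma>\<^sub>B\<^sub>C\<close> under tracing out \<open>C\<close>.
  For \<open>\<sigma> = \<tau>\<close> this is the strong subadditivity of the entropy.\<close>

lemma entropy_submodular:
  assumes N: "N = a * b * c * e" and \<tau>: "\<tau> \<in> carrier_mat N N" "positive_operator \<tau>" and \<sigma>: "\<sigma> \<in> carrier_mat N N"
    and pd: "positive_definite (ptrace a (b * c) e \<sigma>)" "positive_definite (ptrace a b (c * e) \<sigma>)"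
  shows "Re (mat_trace (ptrace 1 (a * b) (c * e) \<tau> * mat_fun ln (ptrace 1 (a * b) (c * e) \<tau>)))
      - Re (mat_trace (ptrace a b (c * e) \<tau> * mat_fun ln (ptrace a b (c * e) \<sigma>)))
    \<le> Re (mat_trace (ptrace 1 (a * b * c) e \<tau> * mat_fun ln (ptrace 1 (a * b * c) e \<tau>)))
      - Re (mat_trace (ptrace a (b * c) e \<tau> * mat_fun ln (ptrace a (b * c) e \<sigma>)))"
proof -
  define A where "A = ptrace 1 (a * b * c) e \<tau>"
  define A' where "A' = ptrace 1 (a * b) (c * e) \<tau>"
  define S where "S = ptrace a (b * c) e \<sigma>"
  define S' where "S' = ptrace a b (c * e) \<sigma>"
  define B where "B = embed a (b * c) 1 S"
  define B' where "B' = embed a b 1 S'"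
  have N': "N = 1 * (a * b * c) * e" "N = 1 * (a * b) * (c * e)" "N = a * (b * c) * e" "N = a * b * (c * e)"
    using N by (simp_all add: mult_ac)
  have A: "A \<in> carrier_mat (a * b * c) (a * b * c)" "A' \<in> carrier_mat (a * b) (a * b)"
    by (simp_all add: A_def A'_def)
  have S: "S \<in> carrier_mat (b * c) (b * c)" "S' \<in> carrier_mat b b" by (simp_all add: S_def S'_def)
  have B: "B \<in> carrier_mat (a * b * c) (a * b * c)" "B' \<in> carrier_mat (a * b) (a * b)"
    by (simp_all add: B_def B'_def embed_carrier)
  have pos: "positive_operator A" "positive_operator A'"
    unfolding A_def A'_def by (intro ptrace_positive[OF N'(1) \<tau>] ptrace_positive[OF N'(2) \<tau>])+
  obtain U \<alpha> where U: "diagonalizes (a * b * c) U \<alpha> A"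
    using hermitian_diagonalizes[OF A(1)] pos(1) unfolding positive_operator_def by blast
  obtain U' \<alpha>' where U': "diagonalizes (a * b) U' \<alpha>' A'"
    using hermitian_diagonalizes[OF A(2)] pos(2) unfolding positive_operator_def by blast
  have \<alpha>: "0 \<le> \<alpha> i" if "i < a * b * c" for i
    using positive_operator_iff_trace(2)[OF A(1) diagonalizes_hermitian[OF U] U] pos(1) that by blast
  have \<alpha>': "0 \<le> \<alpha>' i" if "i < a * b" for i
    using positive_operator_iff_trace(2)[OF A(2) diagonalizes_hermitian[OF U'] U'] pos(2) that by blast
  obtain V s where V: "diagonalizes (b * c) V s S" and s: "\<And>i. i < b * c \<Longrightarrow> 0 < s i"
    using pd(1) S(1) unfolding positive_definite_def S_def[symmetric] by auto
  obtain V' s' where V': "diagonalizes b V' s' S'" and s': "\<And>i. i < b \<Longrightarrow> 0 < s' i"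
    using pd(2) S(2) unfolding positive_definite_def S'_def[symmetric] by auto
  have VB: "diagonalizes (a * b * c) (embed a (b * c) 1 V) (\<lambda>k. s (k div a mod (b * c))) B"
    using diagonalizes_embed[OF V, of a 1] by (simp add: B_def mult.assoc)
  have sB: "0 < s (k div a mod (b * c))" if "k < a * b * c" for k
    using mixed_radix_bounds(2)[of k a "b * c" 1] that by (intro s) (simp add: mult.assoc)
  have VB': "diagonalizes (a * b) (embed a b 1 V') (\<lambda>k. s' (k div a mod b)) B'"
    using diagonalizes_embed[OF V', of a 1] by (simp add: B'_def)
  have sB': "0 < s' (k div a mod b)" if "k < a * b" for k
    using mixed_radix_bounds(2)[of k a b 1] that by (intro s') simp
  have dA: "dual (a * b * c) (a * b) (embed 1 (a * b) c) A A'"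
    unfolding dual_def
  proof (intro conjI A ballI)
    fix X :: "complex mat" assume X: "X \<in> carrier_mat (a * b) (a * b)"
    have "mat_trace (A * embed 1 (a * b) c X) = mat_trace (\<tau> * embed 1 (a * b * c) e (embed 1 (a * b) c X))"
      unfolding A_def by (rule mat_trace_mult_embed[OF N'(1) \<tau>(1), symmetric]) (simp add: embed_carrier)
    also have "embed 1 (a * b * c) e (embed 1 (a * b) c X) = embed 1 (a * b) (c * e) X"
      using embed_embed[of 1 1 "a * b" c e X] by simp
    also have "mat_trace (\<tau> * \<dots>) = mat_trace (A' * X)"
      unfolding A'_def by (rule mat_trace_mult_embed[OF N'(2) \<tau>(1) X])
    finally show "mat_trace (A * embed 1 (a * b) c X) = mat_trace (A' * X)" .
  qed
  \<comment> \<open>\<open>B\<close> and \<open>B'\<close> carry the identity on the left factor, so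
    testing them against \<open>X\<close> traces that factor out of \<open>X\<close>; what remains
    is the duality between two marginals of \<open>\<sigma>\<close>.\<close>
  have dB: "dual (a * b * c) (a * b) (embed 1 (a * b) c) B B'"
    unfolding dual_def
  proof (intro conjI B ballI)
    fix X :: "complex mat" assume X: "X \<in> carrier_mat (a * b) (a * b)"
    let ?Y = "ptrace a b 1 X"
    have E: "embed 1 (a * b) c X \<in> carrier_mat (a * b * c) (a * b * c)" by (simp add: embed_carrier)
    have "mat_trace (B * embed 1 (a * b) c X) = mat_trace (embed 1 (a * b) c X * B)"
      by (rule mat_trace_mult_comm[OF B(1) E])
    also have "\<dots> = mat_trace (ptrace a (b * c) 1 (embed 1 (a * b) c X) * S)"
      unfolding B_def by (rule mat_trace_mult_embed[OF _ E S(1)]) (simp add: mult.assoc)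
    also have "\<dots> = mat_trace (S * embed 1 b c ?Y)"
      unfolding ptrace_left_embed_right by (rule mat_trace_mult_comm[OF _ S(1)]) (simp add: embed_carrier)
    also have "\<dots> = mat_trace (\<sigma> * embed a (b * c) e (embed 1 b c ?Y))"
      unfolding S_def by (rule mat_trace_mult_embed[OF N'(3) \<sigma>(1), symmetric]) (simp add: embed_carrier)
    also have "embed a (b * c) e (embed 1 b c ?Y) = embed a b (c * e) ?Y"
      using embed_embed[of a 1 b c e ?Y] by simp
    also have "mat_trace (\<sigma> * \<dots>) = mat_trace (S' * ?Y)"
      unfolding S'_def by (rule mat_trace_mult_embed[OF N'(4) \<sigma>(1)]) simp
    also have "\<dots> = mat_trace (?Y * S')"
      by (rule mat_trace_mult_comm[OF S(2) ptrace_carrier])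
    also have "\<dots> = mat_trace (X * B')"
      unfolding B'_def by (rule mat_trace_mult_embed[OF _ X S(2), symmetric]) simp
    also have "\<dots> = mat_trace (B' * X)" by (rule mat_trace_mult_comm[OF X B(2)])
    finally show "mat_trace (B * embed 1 (a * b) c X) = mat_trace (B' * X)" .
  qed
  have lnS: "mat_fun ln S \<in> carrier_mat (b * c) (b * c)" "mat_fun ln S' \<in> carrier_mat b b"
    using diagonalizesD(5)[OF diagonalizes_mat_fun[OF V]] diagonalizesD(5)[OF diagonalizes_mat_fun[OF V']] by auto
  \<comment> \<open>The logarithm of \<open>1 \<otimes> S\<close> is
    \<open>1 \<otimes> ln S\<close>, so the cross term sees only the marginal of
    \<open>\<tau>\<close> on the factors \<open>b\<close> and \<open>c\<close>.\<close>
  have tB: "mat_trace (A * mat_fun ln B) = mat_trace (ptrace a (b * c) e \<tau> * mat_fun ln S)"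
  proof -
    have "mat_trace (A * mat_fun ln B) = mat_trace (\<tau> * embed 1 (a * b * c) e (embed a (b * c) 1 (mat_fun ln S)))"
      unfolding A_def B_def mat_fun_embed[OF V]
      by (rule mat_trace_mult_embed[OF N'(1) \<tau>(1), symmetric]) (simp add: embed_carrier mult.assoc)
    also have "embed 1 (a * b * c) e (embed a (b * c) 1 (mat_fun ln S)) = embed a (b * c) e (mat_fun ln S)"
      using embed_embed[of 1 a "b * c" 1 e "mat_fun ln S"] by (simp add: mult.assoc)
    also have "mat_trace (\<tau> * \<dots>) = mat_trace (ptrace a (b * c) e \<tau> * mat_fun ln S)"
      by (rule mat_trace_mult_embed[OF N'(3) \<tau>(1) lnS(1)])
    finally show ?thesis .
  qed
  have tB': "mat_trace (A' * mat_fun ln B') = mat_trace (ptrace a b (c * e) \<tau> * mat_fun ln S')"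
  proof -
    have "mat_trace (A' * mat_fun ln B') = mat_trace (\<tau> * embed 1 (a * b) (c * e) (embed a b 1 (mat_fun ln S')))"
      unfolding A'_def B'_def mat_fun_embed[OF V']
      by (rule mat_trace_mult_embed[OF N'(2) \<tau>(1), symmetric]) (simp add: embed_carrier)
    also have "embed 1 (a * b) (c * e) (embed a b 1 (mat_fun ln S')) = embed a b (c * e) (mat_fun ln S')"
      using embed_embed[of 1 a b 1 "c * e" "mat_fun ln S'"] by simp
    also have "mat_trace (\<tau> * \<dots>) = mat_trace (ptrace a b (c * e) \<tau> * mat_fun ln S')"
      by (rule mat_trace_mult_embed[OF N'(4) \<tau>(1) lnS(2)])
    finally show ?thesis .
  qed
  have "Re (mat_trace (A' * mat_fun ln A')) - Re (mat_trace (A' * mat_fun ln B'))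
      \<le> Re (mat_trace (A * mat_fun ln A)) - Re (mat_trace (A * mat_fun ln B))"
  proof (rule relative_entropy_mono[OF _ _ _ _ U _ VB _ U' _ VB' _ dA dB])
    show "embed 1 (a * b) c X \<in> carrier_mat (a * b * c) (a * b * c)" for X
      by (simp add: embed_carrier)
    show "embed 1 (a * b) c (1\<^sub>m (a * b)) = 1\<^sub>m (a * b * c)"
      using embed_one[of 1 "a * b" c] by simp
  qed (auto intro: embed_mult embed_adjoint \<alpha> sB \<alpha>' sB')
  then show ?thesis
    unfolding tB tB' unfolding A_def A'_def S_def S'_def .
qed

section \<open>Intervals of a chain\<close>

lemma sub_dim_interval_split:
  assumes "q \<le> p" "p \<le> s"
  shows "sub_dim d {q..<s} = sub_dim d {q..<p} * sub_dim d {p..<s}"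
  unfolding sub_dim_def using prod.atLeastLessThan_concat[OF assms, of d] by simp

lemma sub_dim_empty [simp]: "sub_dim d {} = 1"
  by (simp add: sub_dim_def)

lemma sub_dim_chain:
  assumes "1 \<le> q" "q \<le> s" "s \<le> Suc m"
  shows "sub_dim d {1..m} = sub_dim d {1..<q} * sub_dim d {q..<s} * sub_dim d {s..<Suc m}"
proof -
  have "{1..m} = {1..<Suc m}" by auto
  then show ?thesis
    using assms sub_dim_interval_split[of 1 q "Suc m" d] sub_dim_interval_split[of q s "Suc m" d]
    by (simp add: mult.assoc)
qed

text \<open>The digits of consecutive sites form one contiguous block of the mixed-radix expansion;
  the induction puts the digit of the next site on top.\<close>

lemma sub_index_interval:
  assumes "1 \<le> q" "q \<le> s"
  shows "sub_index d {q..<s} k = k div sub_dim d {1..<q} mod sub_dim d {q..<s}"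
  using assms(2)
proof (induction s rule: dec_induct)
  case base
  then show ?case by (simp add: sub_index_def)
next
  case (step s)
  have "(\<Sum>j\<in>{q..<s}. site_index d j k * sub_dim d {l \<in> {q..<Suc s}. l < j}) = sub_index d {q..<s} k"
    unfolding sub_index_def
    by (intro sum.cong refl arg_cong2[where f = "(*)"] arg_cong[where f = "sub_dim d"]) auto
  moreover have "{l \<in> {q..<Suc s}. l < s} = {q..<s}" by auto
  ultimately have "sub_index d {q..<Suc s} k = site_index d s k * sub_dim d {q..<s} + sub_index d {q..<s} k"
    using step(1) unfolding sub_index_def[of d "{q..<Suc s}"] by (simp add: atLeastLessThanSuc)
  moreover have "site_index d s k = k div sub_dim d {1..<q} div sub_dim d {q..<s} mod d s"
    unfolding site_index_def using sub_dim_interval_split[of 1 q s d] assms(1) step(1)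
    by (simp add: div_mult2_eq)
  moreover have "sub_dim d {q..<Suc s} = sub_dim d {q..<s} * d s"
    using step(1) by (simp add: sub_dim_def)
  ultimately show ?case
    using step.IH by (simp only: mod_mult2_eq mult.commute[of _ "sub_dim d {q..<s}"])
qed

text \<open>The digits below \<open>q\<close> and those from \<open>s\<close> on close up to one
  number. The bound on \<open>k\<close> makes the final reduction of the upper block
  trivial.\<close>

lemma sub_index_complement:
  assumes "1 \<le> q" "q \<le> s" "s \<le> Suc m" "k < sub_dim d {1..m}"
  shows "sub_index d ({1..m} - {q..<s}) k = k mod sub_dim d {1..<q}
    + sub_dim d {1..<q} * (k div (sub_dim d {1..<q} * sub_dim d {q..<s}))"
proof -
  have C: "{1..m} - {q..<s} = {1..<q} \<union> {s..<Suc m}" using assms by auto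
  let ?C = "{1..<q} \<union> {s..<Suc m}"
  have "(\<Sum>j\<in>{1..<q}. site_index d j k * sub_dim d {l \<in> ?C. l < j}) = sub_index d {1..<q} k"
    unfolding sub_index_def using assms(2)
    by (intro sum.cong refl arg_cong2[where f = "(*)"] arg_cong[where f = "sub_dim d"]) auto
  moreover have "(\<Sum>j\<in>{s..<Suc m}. site_index d j k * sub_dim d {l \<in> ?C. l < j}) =
      sub_dim d {1..<q} * sub_index d {s..<Suc m} k"
    unfolding sub_index_def sum_distrib_left
  proof (intro sum.cong refl)
    fix j assume j: "j \<in> {s..<Suc m}"
    then have "{l \<in> ?C. l < j} = {1..<q} \<union> {l \<in> {s..<Suc m}. l < j}" using assms(2) by auto
    moreover have "{1..<q} \<inter> {l \<in> {s..<Suc m}. l < j} = {}" using assms(2) by auto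
    ultimately have "sub_dim d {l \<in> ?C. l < j} = sub_dim d {1..<q} * sub_dim d {l \<in> {s..<Suc m}. l < j}"
      unfolding sub_dim_def by (simp add: prod.union_disjoint)
    then show "site_index d j k * sub_dim d {l \<in> ?C. l < j} =
        sub_dim d {1..<q} * (site_index d j k * sub_dim d {l \<in> {s..<Suc m}. l < j})"
      by (simp add: mult.left_commute)
  qed
  moreover have "{1..<q} \<inter> {s..<Suc m} = {}" using assms(2) by auto
  ultimately have "sub_index d ({1..m} - {q..<s}) k = sub_index d {1..<q} k + sub_dim d {1..<q} * sub_index d {s..<Suc m} k"
    unfolding C sub_index_def[of d ?C] by (simp add: sum.union_disjoint)
  moreover have "sub_index d {1..<q} k = k mod sub_dim d {1..<q}"
    using sub_index_interval[of 1 q d k] assms(1) by simp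
  moreover have "sub_index d {s..<Suc m} k = k div (sub_dim d {1..<q} * sub_dim d {q..<s})"
  proof -
    have "sub_dim d {1..<s} = sub_dim d {1..<q} * sub_dim d {q..<s}"
      using assms by (intro sub_dim_interval_split) auto
    moreover have "k div (sub_dim d {1..<q} * sub_dim d {q..<s}) < sub_dim d {s..<Suc m}"
      using assms(4) unfolding sub_dim_chain[OF assms(1-3)] by (rule mixed_radix_bounds)
    ultimately show ?thesis using sub_index_interval[of s "Suc m" d k] assms by simp
  qed
  ultimately show ?thesis by simp
qed

lemma sub_index_complement_eq_iff:
  assumes "1 \<le> q" "q \<le> s" "s \<le> Suc m" "k < sub_dim d {1..m}" "l < sub_dim d {1..m}"
  shows "sub_index d ({1..m} - {q..<s}) k = sub_index d ({1..m} - {q..<s}) l \<longleftrightarrow>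
    k mod sub_dim d {1..<q} = l mod sub_dim d {1..<q} \<and>
    k div (sub_dim d {1..<q} * sub_dim d {q..<s}) = l div (sub_dim d {1..<q} * sub_dim d {q..<s})"
proof -
  have "k mod sub_dim d {1..<q} < sub_dim d {1..<q}" "l mod sub_dim d {1..<q} < sub_dim d {1..<q}"
    using assms(4,5)[unfolded sub_dim_chain[OF assms(1-3)], THEN mixed_radix_bounds(1)] by auto
  then show ?thesis
    unfolding sub_index_complement[OF assms(1-4)] sub_index_complement[OF assms(1-3,5)]
    by (rule mixed_radix_inj)
qed

lemma extend_op_interval:
  assumes "1 \<le> q" "q \<le> s" "s \<le> Suc m"
  shows "extend_op d m {q..<s} X = embed (sub_dim d {1..<q}) (sub_dim d {q..<s}) (sub_dim d {s..<Suc m}) X"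
  unfolding extend_op_def embed_def sub_dim_chain[OF assms, symmetric]
  by (intro cong_mat refl) (simp add: sub_index_complement_eq_iff[OF assms] sub_index_interval[OF assms(1,2)] del: One_nat_def)

text \<open>A contributing pair of indices has the prescribed middle digits \<open>i\<close>,
  \<open>j\<close> and common outer digits, so the pairs are parametrised by the outer digits
  \<open>(x, z)\<close>.\<close>

lemma reduced_state_interval:
  assumes "1 \<le> q" "q \<le> s" "s \<le> Suc m"
  shows "reduced_state d m {q..<s} M = ptrace (sub_dim d {1..<q}) (sub_dim d {q..<s}) (sub_dim d {s..<Suc m}) M"
    (is "_ = ptrace ?a ?b ?c M")
proof (rule eq_matI)
  fix i j assume "i < dim_row (ptrace ?a ?b ?c M)" "j < dim_col (ptrace ?a ?b ?c M)"
  then have ij: "i < ?b" "j < ?b" by auto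
  let ?N = "sub_dim d {1..m}"
  note N = sub_dim_chain[OF assms, of d]
  let ?S = "{(k, l). k < ?N \<and> l < ?N \<and> sub_index d {q..<s} k = i \<and> sub_index d {q..<s} l = j \<and>
    sub_index d ({1..m} - {q..<s}) k = sub_index d ({1..m} - {q..<s}) l}"
  have S: "(k, l) \<in> ?S \<longleftrightarrow> k < ?N \<and> l < ?N \<and> k div ?a mod ?b = i \<and> l div ?a mod ?b = j \<and>
      k mod ?a = l mod ?a \<and> k div (?a * ?b) = l div (?a * ?b)" for k l
    using sub_index_complement_eq_iff[OF assms, of k d l] sub_index_interval[OF assms(1,2), of d] by auto
  have "(\<Sum>(k, l)\<in>?S. M $$ (k, l)) = (\<Sum>(x, z)\<in>{..<?a} \<times> {..<?c}. M $$ (x + ?a * (i + ?b * z), x + ?a * (j + ?b * z)))"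
  proof (rule sum.reindex_bij_witness[where i = "\<lambda>(x, z). (x + ?a * (i + ?b * z), x + ?a * (j + ?b * z))"
        and j = "\<lambda>(k, l). (k mod ?a, k div (?a * ?b))"])
    fix p assume p: "p \<in> ?S"
    obtain k l where kl: "p = (k, l)" by (cases p)
    note * = p[unfolded kl S]
    have k: "k = k mod ?a + ?a * (i + ?b * (k div (?a * ?b)))"
      using mixed_radix_split[of k ?a ?b] * by simp
    have l: "l = k mod ?a + ?a * (j + ?b * (k div (?a * ?b)))"
      using mixed_radix_split[of l ?a ?b] * by simp
    show "(case case p of (k, l) \<Rightarrow> (k mod ?a, k div (?a * ?b)) of (x, z) \<Rightarrow> (x + ?a * (i + ?b * z), x + ?a * (j + ?b * z))) = p"
      unfolding kl using k l by simp
    show "(case p of (k, l) \<Rightarrow> (k mod ?a, k div (?a * ?b))) \<in> {..<?a} \<times> {..<?c}"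
      unfolding kl using * mixed_radix_bounds(1,3)[of k ?a ?b ?c] N by simp
    show "(case case p of (k, l) \<Rightarrow> (k mod ?a, k div (?a * ?b)) of (x, z) \<Rightarrow> M $$ (x + ?a * (i + ?b * z), x + ?a * (j + ?b * z)))
        = (case p of (k, l) \<Rightarrow> M $$ (k, l))"
      unfolding kl using k l by simp
  next
    fix p assume "p \<in> {..<?a} \<times> {..<?c}"
    then obtain x z where xz: "p = (x, z)" "x < ?a" "z < ?c" by auto
    note dig = mixed_radix_digits[OF xz(2) ij(1)] mixed_radix_digits[OF xz(2) ij(2)]
    show "(case case p of (x, z) \<Rightarrow> (x + ?a * (i + ?b * z), x + ?a * (j + ?b * z)) of (k, l) \<Rightarrow> (k mod ?a, k div (?a * ?b))) = p"
      unfolding xz(1) using dig by simp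
    have "x + ?a * (i + ?b * z) < ?N" "x + ?a * (j + ?b * z) < ?N"
      unfolding N mult.assoc using xz ij by (auto intro!: mixed_radix_less)
    then show "(case p of (x, z) \<Rightarrow> (x + ?a * (i + ?b * z), x + ?a * (j + ?b * z))) \<in> ?S"
      unfolding xz(1) split S using dig by simp
  qed
  then show "reduced_state d m {q..<s} M $$ (i, j) = ptrace ?a ?b ?c M $$ (i, j)"
    using ij by (simp add: reduced_state_def ptrace_def sum.cartesian_product)
qed (simp_all add: reduced_state_def)

lemma reduced_state_carrier: "n = sub_dim d X \<Longrightarrow> reduced_state d m X M \<in> carrier_mat n n"
  by (simp add: reduced_state_def)

lemma reduced_state_dims [simp]:
  "dim_row (reduced_state d m X M) = sub_dim d X" "dim_col (reduced_state d m X M) = sub_dim d X"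
  by (simp_all add: reduced_state_def)

lemma extend_op_carrier [simp]: "extend_op d m X A \<in> carrier_mat (sub_dim d {1..m}) (sub_dim d {1..m})"
  by (simp add: extend_op_def)

lemma mat_trace_mult_extend_op:
  assumes "1 \<le> q" "q \<le> s" "s \<le> Suc m" "M \<in> carrier_mat (sub_dim d {1..m}) (sub_dim d {1..m})"
    "X \<in> carrier_mat (sub_dim d {q..<s}) (sub_dim d {q..<s})"
  shows "mat_trace (M * extend_op d m {q..<s} X) = mat_trace (reduced_state d m {q..<s} M * X)"
  unfolding extend_op_interval[OF assms(1-3)] reduced_state_interval[OF assms(1-3)]
  by (rule mat_trace_mult_embed[OF sub_dim_chain[OF assms(1-3)] assms(4,5)])

lemma reduced_state_density_operator:
  assumes "1 \<le> q" "q \<le> s" "s \<le> Suc m" "density_operator (sub_dim d {1..m}) M"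
  shows "density_operator (sub_dim d {q..<s}) (reduced_state d m {q..<s} M)"
proof -
  note N = sub_dim_chain[OF assms(1-3), of d]
  have M: "M \<in> carrier_mat (sub_dim d {1..m}) (sub_dim d {1..m})" "positive_operator M" "mat_trace M = 1"
    using assms(4) by (auto simp: density_operator_def)
  show ?thesis
    unfolding density_operator_def reduced_state_interval[OF assms(1-3)]
    using ptrace_positive[OF N M(1,2)] mat_trace_ptrace[OF N M(1)] M(3) by simp
qed

lemma reduced_state_all:
  assumes "M \<in> carrier_mat (sub_dim d {1..m}) (sub_dim d {1..m})"
  shows "reduced_state d m {1..<Suc m} M = M"
proof -
  have "{1..<Suc m} = {1..m}" by auto
  then have "reduced_state d m {1..<Suc m} M = ptrace 1 (sub_dim d {1..m}) 1 M"
    using reduced_state_interval[of 1 "Suc m" m d M] by simp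
  also have "\<dots> = M" by (rule eq_matI) (use assms in \<open>auto simp: ptrace_def\<close>)
  finally show ?thesis .
qed

text \<open>The tensor factors are the sites before \<open>q\<close>, those from \<open>q\<close> to
  \<open>p - 1\<close>, those from \<open>p\<close> to \<open>s - 1\<close>, and the rest. Any of
  them may be empty, with dimension 1.\<close>

lemma entropy_submodular_chain:
  fixes d m
  defines "R \<equiv> \<lambda>M q s. reduced_state d m {q..<s} M" and "N \<equiv> sub_dim d {1..m}"
  assumes le: "1 \<le> q" "q \<le> p" "p \<le> s" "s \<le> Suc m"
    and \<tau>: "\<tau> \<in> carrier_mat N N" "positive_operator \<tau>" and \<sigma>: "\<sigma> \<in> carrier_mat N N"
    and pd: "positive_definite (R \<sigma> q s)" "positive_definite (R \<sigma> q p)"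
  shows "Re (mat_trace (R \<tau> 1 p * mat_fun ln (R \<tau> 1 p))) - Re (mat_trace (R \<tau> q p * mat_fun ln (R \<sigma> q p)))
    \<le> Re (mat_trace (R \<tau> 1 s * mat_fun ln (R \<tau> 1 s))) - Re (mat_trace (R \<tau> q s * mat_fun ln (R \<sigma> q s)))"
proof -
  define a b c e where "a = sub_dim d {1..<q}" and "b = sub_dim d {q..<p}" and "c = sub_dim d {p..<s}"
    and "e = sub_dim d {s..<Suc m}"
  have dims: "sub_dim d {1..<p} = a * b" "sub_dim d {1..<s} = a * b * c" "sub_dim d {q..<s} = b * c"
    "sub_dim d {p..<Suc m} = c * e"
    using le sub_dim_interval_split[of 1 q p d] sub_dim_interval_split[of 1 p s d] sub_dim_interval_split[of q p s d]
      sub_dim_interval_split[of p s "Suc m" d]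
    by (simp_all add: a_def b_def c_def e_def)
  have N: "N = a * b * c * e"
    using sub_dim_chain[of 1 s m d] le dims(2) by (simp add: N_def e_def)
  have R: "R M 1 p = ptrace 1 (a * b) (c * e) M" "R M 1 s = ptrace 1 (a * b * c) e M"
    "R M q p = ptrace a b (c * e) M" "R M q s = ptrace a (b * c) e M" for M
    using le reduced_state_interval[of 1 p m d M] reduced_state_interval[of 1 s m d M]
      reduced_state_interval[of q p m d M] reduced_state_interval[of q s m d M]
    by (simp_all add: R_def dims del: One_nat_def flip: a_def b_def c_def e_def)
  show ?thesis
    using entropy_submodular[OF N \<tau> \<sigma>] pd unfolding R by blast
qed

section \<open>Perturbation to full rank\<close>

definition full_rank_perturbation :: "nat \<Rightarrow> real \<Rightarrow> complex mat \<Rightarrow> complex mat" where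
  "full_rank_perturbation n \<delta> M =
     complex_of_real (1 - \<delta>) \<cdot>\<^sub>m M + complex_of_real (\<delta> / n) \<cdot>\<^sub>m 1\<^sub>m n"

lemma density_operator_dim_pos: "density_operator n M \<Longrightarrow> 0 < n"
  by (rule gr0I) (auto simp: density_operator_def mat_trace_def)

text \<open>\<open>M\<close> and \<open>P\<close> share an eigenbasis, so everything reduces to
  their spectra. The upper bound is the Gibbs inequality for two probability vectors; the lower
  bound comes from \<open>b i \<ge> (1 - \<delta>) * a i\<close>.\<close>

lemma full_rank_perturbation_entropy:
  assumes M: "density_operator n M" and \<delta>: "0 < \<delta>" "\<delta> < 1"
  defines "P \<equiv> full_rank_perturbation n \<delta> M"
  shows "positive_definite P"
    and "Re (mat_trace (M * mat_fun ln P)) \<le> Re (mat_trace (M * mat_fun ln M))"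
    and "Re (mat_trace (M * mat_fun ln M)) + ln (1 - \<delta>) \<le> Re (mat_trace (M * mat_fun ln P))"
proof -
  have Mc: "M \<in> carrier_mat n n" "positive_operator M" "mat_trace M = 1"
    using M by (auto simp: density_operator_def)
  then have h: "hermitian M" by (simp add: positive_operator_def)
  obtain U a where U: "diagonalizes n U a M" using hermitian_diagonalizes[OF Mc(1) h] .
  have a: "0 \<le> a i" if "i < n" for i
    using positive_operator_iff_trace(2)[OF Mc(1) h U] Mc(2) that by blast
  have n: "0 < n" by (rule density_operator_dim_pos[OF M])
  have suma: "(\<Sum>i<n. a i) = 1" using mat_trace_diagonalizes[OF U] Mc(3) by (metis of_real_eq_1_iff of_real_sum)
  define b where "b i = (1 - \<delta>) * a i + \<delta> / n" for i
  have Pb: "diagonalizes n U b P"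
    unfolding P_def full_rank_perturbation_def b_def
    by (rule diagonalizes_one_shift[OF diagonalizes_smult[OF U]])
  have bpos: "0 < b i" if "i < n" for i
    unfolding b_def using \<delta> n a[OF that] by (intro add_nonneg_pos) auto
  have sumb: "(\<Sum>i<n. b i) = 1"
    using n by (simp add: b_def sum.distrib suma flip: sum_distrib_left)
  show "positive_definite P"
    unfolding positive_definite_def using Pb bpos diagonalizesD(5)[OF Pb] by auto
  have MP: "Re (mat_trace (M * mat_fun ln P)) = (\<Sum>i<n. a i * ln (b i))"
    using mat_trace_mult_commuting[OF U diagonalizes_mat_fun[OF Pb]] by simp
  have MM: "Re (mat_trace (M * mat_fun ln M)) = (\<Sum>i<n. a i * ln (a i))"
    using mat_trace_mat_fun[OF U] by simp
  have "(\<Sum>i<n. a i * ln (b i)) \<le> (\<Sum>i<n. a i * ln (a i) + (b i - a i))"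
  proof (rule sum_mono)
    fix i assume "i \<in> {..<n}"
    then have i: "i < n" by simp
    show "a i * ln (b i) \<le> a i * ln (a i) + (b i - a i)"
    proof (cases "a i = 0")
      case True
      then show ?thesis using bpos[OF i] by simp
    next
      case False
      then have ai: "a i > 0" using a[OF i] by simp
      \<comment> \<open>The linear terms that this estimate introduces sum to zero, as both spectra
        sum to 1.\<close>
      have "ln (b i / a i) \<le> b i / a i - 1" using ai bpos[OF i] by (intro ln_le_minus_one) simp
      then have "a i * ln (b i / a i) \<le> a i * (b i / a i - 1)" using ai by (intro mult_left_mono) auto
      then show ?thesis using ai bpos[OF i] by (simp add: ln_div algebra_simps)
    qed
  qed
  then show "Re (mat_trace (M * mat_fun ln P)) \<le> Re (mat_trace (M * mat_fun ln M))"
    unfolding MP MM by (simp add: sum.distrib sum_subtractf suma sumb)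
  have "(\<Sum>i<n. a i * ln (a i) + a i * ln (1 - \<delta>)) \<le> (\<Sum>i<n. a i * ln (b i))"
  proof (rule sum_mono)
    fix i assume "i \<in> {..<n}"
    then have i: "i < n" by simp
    show "a i * ln (a i) + a i * ln (1 - \<delta>) \<le> a i * ln (b i)"
    proof (cases "a i = 0")
      case False
      then have ai: "a i > 0" using a[OF i] by simp
      have "ln (a i) + ln (1 - \<delta>) = ln ((1 - \<delta>) * a i)" using ai \<delta> by (simp add: ln_mult)
      also have "\<dots> \<le> ln (b i)" using ai \<delta> n by (simp add: b_def ln_le_cancel_iff add_pos_pos)
      finally show ?thesis using ai by (simp flip: distrib_left)
    qed simp
  qed
  then show "Re (mat_trace (M * mat_fun ln M)) + ln (1 - \<delta>) \<le> Re (mat_trace (M * mat_fun ln P))"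
    unfolding MP MM by (simp add: sum.distrib suma flip: sum_distrib_right)
qed

text \<open>The maximally mixed state has maximally mixed marginals: the dimensions of the factors
  traced out cancel in the normalisation.\<close>

lemma reduced_state_full_rank_perturbation:
  assumes "1 \<le> q" "q \<le> s" "s \<le> Suc m" "M \<in> carrier_mat (sub_dim d {1..m}) (sub_dim d {1..m})" "0 < sub_dim d {1..m}"
  shows "reduced_state d m {q..<s} (full_rank_perturbation (sub_dim d {1..m}) \<delta> M) =
    full_rank_perturbation (sub_dim d {q..<s}) \<delta> (reduced_state d m {q..<s} M)"
proof -
  let ?a = "sub_dim d {1..<q}" and ?b = "sub_dim d {q..<s}" and ?c = "sub_dim d {s..<Suc m}"
  note N = sub_dim_chain[OF assms(1-3), of d]
  have pos: "?a > 0" "?b > 0" "?c > 0" using assms(5) unfolding N by auto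
  have "of_nat (?a * ?c) * complex_of_real (\<delta> / sub_dim d {1..m}) = complex_of_real (\<delta> / ?b)"
    unfolding N using pos by (simp add: field_simps)
  then show ?thesis
    unfolding full_rank_perturbation_def reduced_state_interval[OF assms(1-3)] ptrace_add_smult_one[OF N assms(4)]
    by simp
qed

section \<open>Gibbs states\<close>

declare One_nat_def [simp del]

lemma mat_trace_mult_uminus_shift:
  assumes "A \<in> carrier_mat n n" "H \<in> carrier_mat n n"
  shows "mat_trace (A * (- H + c \<cdot>\<^sub>m 1\<^sub>m n)) = - mat_trace (A * H) + c * mat_trace A"
proof -
  have "mat_trace (A * (- H + c \<cdot>\<^sub>m 1\<^sub>m n)) =
      (\<Sum>i<n. \<Sum>j<n. - (A $$ (i, j) * H $$ (j, i)) + (if i = j then c * A $$ (i, j) else 0))"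
    by (subst mat_trace_mult[OF assms(1)]) (use assms in \<open>auto intro!: sum.cong simp: algebra_simps\<close>)
  also have "\<dots> = - (\<Sum>i<n. \<Sum>j<n. A $$ (i, j) * H $$ (j, i)) + c * (\<Sum>i<n. A $$ (i, i))"
    by (simp add: sum_subtractf sum_distrib_left)
  finally show ?thesis
    unfolding mat_trace_mult[OF assms] using assms(1) by (simp add: mat_trace_def[of A])
qed

lemma mat_sum_carrier [simp]: "mat_sum n h I \<in> carrier_mat n n"
  by (simp add: mat_sum_def)

lemma mat_sum_hermitian:
  assumes "\<And>i. i \<in> I \<Longrightarrow> hermitian (h i)" "\<And>i. i \<in> I \<Longrightarrow> h i \<in> carrier_mat n n"
  shows "hermitian (mat_sum n h I)"
proof (rule hermitianI[OF mat_sum_carrier], rule eq_matI)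
  fix k l assume "k < dim_row (mat_sum n h I)" "l < dim_col (mat_sum n h I)"
  then have kl: "k < n" "l < n" by (auto simp: mat_sum_def)
  have "cnj (h i $$ (l, k)) = h i $$ (k, l)" if "i \<in> I" for i
    using hermitian_index[OF assms(1,2)[OF that] kl] by simp
  then show "mat_adjoint (mat_sum n h I) $$ (k, l) = mat_sum n h I $$ (k, l)"
    using kl by (simp add: mat_sum_def)
qed (auto simp: mat_sum_def)

lemma mat_trace_mult_mat_sum:
  assumes "M \<in> carrier_mat n n" "\<And>i. i \<in> I \<Longrightarrow> h i \<in> carrier_mat n n"
  shows "mat_trace (M * mat_sum n h I) = (\<Sum>i\<in>I. mat_trace (M * h i))"
proof -
  have "mat_trace (M * mat_sum n h I) = (\<Sum>k<n. \<Sum>l<n. \<Sum>i\<in>I. M $$ (k, l) * h i $$ (l, k))"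
    unfolding mat_trace_mult[OF assms(1) mat_sum_carrier] by (simp add: mat_sum_def sum_distrib_left)
  also have "\<dots> = (\<Sum>k<n. \<Sum>i\<in>I. \<Sum>l<n. M $$ (k, l) * h i $$ (l, k))"
    by (intro sum.cong refl sum.swap)
  also have "\<dots> = (\<Sum>i\<in>I. \<Sum>k<n. \<Sum>l<n. M $$ (k, l) * h i $$ (l, k))"
    by (rule sum.swap)
  also have "\<dots> = (\<Sum>i\<in>I. mat_trace (M * h i))"
    by (intro sum.cong refl) (simp add: mat_trace_mult[OF assms(1) assms(2)])
  finally show ?thesis .
qed

text \<open>One eigenbasis of \<open>- H\<close> diagonalises everything; \<open>z\<close> is the
  partition function, so the logarithm of the Gibbs state is \<open>- H - ln z\<close>.\<close>

lemma gibbs_state_diagonalizes: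
  assumes H: "H \<in> carrier_mat n n" "hermitian H" and n: "0 < n"
  obtains U f z where "diagonalizes n U f (gibbs_state H)" "\<And>i. i < n \<Longrightarrow> 0 < f i" "(\<Sum>i<n. f i) = 1"
    "mat_fun ln (gibbs_state H) = - H + complex_of_real (- ln z) \<cdot>\<^sub>m 1\<^sub>m n" "0 < z"
proof -
  have mH: "- H \<in> carrier_mat n n" using H by simp
  have "hermitian (- H)"
    using hermitianD(1)[OF H(2)] by (intro hermitianI[OF mH]) (simp add: mat_adjoint_uminus)
  from hermitian_diagonalizes[OF mH this] obtain U g where U: "diagonalizes n U g (- H)" .
  define z where "z = (\<Sum>i<n. exp (g i))"
  have z: "0 < z" unfolding z_def using n by (intro sum_pos) auto
  define f where "f i = exp (g i) / z" for i
  have tr: "mat_trace (mat_exp (- H)) = complex_of_real z"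
    unfolding z_def mat_trace_diagonalizes[OF diagonalizes_mat_exp[OF U]] by simp
  have Gf: "diagonalizes n U f (gibbs_state H)"
    using diagonalizes_smult[OF diagonalizes_mat_exp[OF U], of "1 / z"]
    by (simp add: gibbs_state_def tr f_def[abs_def])
  moreover have "(\<Sum>i<n. f i) = 1" using z by (simp add: f_def z_def flip: sum_divide_distrib)
  moreover have "mat_fun ln (gibbs_state H) = - H + complex_of_real (- ln z) \<cdot>\<^sub>m 1\<^sub>m n"
    unfolding mat_fun_eq[OF Gf] diagonalizesD(4)[OF diagonalizes_one_shift[OF U, of "- ln z"]]
    using z by (simp add: f_def ln_div)
  ultimately show ?thesis using z by (intro that[of U f z]) (auto simp: f_def)
qed

text \<open>This puts the relative entropy to a Gibbs state into the finite branch of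
  \<open>rel_entropy\<close>; preimages come from the inverted eigenvalues.\<close>

lemma mat_range_full:
  assumes "diagonalizes n U f A" "\<And>i. i < n \<Longrightarrow> f i \<noteq> 0"
  shows "carrier_vec n \<subseteq> mat_range A"
proof
  fix v :: "complex vec" assume v: "v \<in> carrier_vec n"
  note U = diagonalizesD[OF assms(1)]
  note assoc = assoc_mult_mat[of _ n n _ n _ n]
  let ?B = "U * real_diag n (\<lambda>i. 1 / f i) * mat_adjoint U"
  have B: "?B \<in> carrier_mat n n" using U(1) by simp
  have "A * ?B = U * (real_diag n f * real_diag n (\<lambda>i. 1 / f i)) * mat_adjoint U"
    unfolding U(4) using U(1,2) by (simp add: assoc unitary_cancel del: mat_diag_diag)
  also have "real_diag n f * real_diag n (\<lambda>i. 1 / f i) = 1\<^sub>m n"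
    unfolding mat_diag_diag by (rule eq_matI) (use assms(2) in \<open>auto simp: mat_diag_def\<close>)
  finally have "A * ?B = 1\<^sub>m n" using U(1,3) by simp
  then have "A *\<^sub>v (?B *\<^sub>v v) = v" using U(5) B v by (simp flip: assoc_mult_mat_vec[of _ n n _ n])
  moreover have "?B *\<^sub>v v \<in> carrier_vec (dim_col A)" using B v U(5) by auto
  ultimately show "v \<in> mat_range A" unfolding mat_range_def by (metis image_eqI)
qed

lemma mat_range_subset: "A \<in> carrier_mat n n \<Longrightarrow> mat_range A \<subseteq> carrier_vec n"
  by (auto simp: mat_range_def)

lemma mat_trace_mult_mat_log2:
  assumes U: "diagonalizes n U a A" and M: "M \<in> carrier_mat n n"
  shows "mat_log2 A \<in> carrier_mat n n"
    and "mat_trace (M * mat_log2 A) = complex_of_real (1 / ln 2) * mat_trace (M * mat_fun ln A)"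
proof -
  have L: "mat_fun ln A \<in> carrier_mat n n" by (rule diagonalizesD(5)[OF diagonalizes_mat_fun[OF U]])
  then show "mat_log2 A \<in> carrier_mat n n" unfolding mat_log2_eq[OF U] by simp
  have "M * mat_log2 A = complex_of_real (1 / ln 2) \<cdot>\<^sub>m (M * mat_fun ln A)"
    unfolding mat_log2_eq[OF U] by (rule mult_smult_distrib[OF M L])
  then show "mat_trace (M * mat_log2 A) = complex_of_real (1 / ln 2) * mat_trace (M * mat_fun ln A)"
    using mat_trace_smult[OF mult_square_carrier[OF M L]] by simp
qed

text \<open>The same \<open>z\<close> occurs in the logarithm of the Gibbs state and in the relative
  entropy of \<open>M\<close>, so a bound on \<open>ln z\<close> derived from the Gibbs state
  carries over. The divisor \<open>ln 2\<close> converts to base 2.\<close>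

lemma rel_entropy_gibbs_state:
  assumes M: "density_operator n M" and H: "H \<in> carrier_mat n n" "hermitian H"
  obtains z where "0 < z"
    "mat_fun ln (gibbs_state H) = - H + complex_of_real (- ln z) \<cdot>\<^sub>m 1\<^sub>m n"
    "density_operator n (gibbs_state H)"
    "rel_entropy M (gibbs_state H) = ereal ((Re (mat_trace (M * mat_fun ln M)) + Re (mat_trace (M * H)) + ln z) / ln 2)"
proof -
  have n: "0 < n" by (rule density_operator_dim_pos[OF M])
  have Mc: "M \<in> carrier_mat n n" "positive_operator M" "mat_trace M = 1"
    using M by (auto simp: density_operator_def)
  then have "hermitian M" by (simp add: positive_operator_def)
  from hermitian_diagonalizes[OF Mc(1) this] obtain V a where V: "diagonalizes n V a M" .
  obtain U f z where U: "diagonalizes n U f (gibbs_state H)" and f: "\<And>i. i < n \<Longrightarrow> 0 < f i" "(\<Sum>i<n. f i) = 1"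
    and ln: "mat_fun ln (gibbs_state H) = - H + complex_of_real (- ln z) \<cdot>\<^sub>m 1\<^sub>m n" and z: "0 < z"
    by (rule gibbs_state_diagonalizes[OF H n]) (rule that)
  have "positive_operator (gibbs_state H)"
    unfolding positive_operator_iff_trace(2)[OF diagonalizesD(5)[OF U] diagonalizes_hermitian[OF U] U]
    using f(1) by (simp add: less_imp_le)
  then have dens: "density_operator n (gibbs_state H)"
    using diagonalizesD(5)[OF U] mat_trace_diagonalizes[OF U] f(2)
    by (simp add: density_operator_def flip: of_real_sum)
  have range: "mat_range M \<subseteq> mat_range (gibbs_state H)"
    using mat_range_subset[OF Mc(1)] mat_range_full[OF U] f(1) by force
  define T where "T = mat_fun ln (gibbs_state H)"
  note log2M = mat_trace_mult_mat_log2[OF V Mc(1)] and log2T = mat_trace_mult_mat_log2[OF U Mc(1)]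
  have "M * (mat_log2 M - mat_log2 (gibbs_state H)) = M * mat_log2 M - M * mat_log2 (gibbs_state H)"
    by (rule mult_minus_distrib_mat[OF Mc(1) log2M(1) log2T(1)])
  then have "mat_trace (M * (mat_log2 M - mat_log2 (gibbs_state H))) =
      mat_trace (M * mat_log2 M) - mat_trace (M * mat_log2 (gibbs_state H))"
    using mat_trace_minus[OF mult_square_carrier[OF Mc(1) log2M(1)] mult_square_carrier[OF Mc(1) log2T(1)]] by simp
  also have "\<dots> = complex_of_real (1 / ln 2) * (mat_trace (M * mat_fun ln M) - mat_trace (M * T))"
    unfolding log2M(2) log2T(2) T_def by (rule right_diff_distrib[symmetric])
  also have "mat_trace (M * T) = - mat_trace (M * H) + complex_of_real (- ln z) * mat_trace M"
    unfolding T_def ln by (rule mat_trace_mult_uminus_shift[OF Mc(1) H(1)])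
  finally have "Re (mat_trace (M * (mat_log2 M - mat_log2 (gibbs_state H)))) =
      (Re (mat_trace (M * mat_fun ln M)) + Re (mat_trace (M * H)) + ln z) / ln 2"
    by (simp add: Mc(3))
  then have "rel_entropy M (gibbs_state H) = ereal ((Re (mat_trace (M * mat_fun ln M)) + Re (mat_trace (M * H)) + ln z) / ln 2)"
    unfolding rel_entropy_def using range by simp
  from that[OF z ln dens this] show ?thesis .
qed

section \<open>The local Hamiltonian of a chain\<close>

lemma reduced_state_empty:
  assumes "density_operator (sub_dim d {1..m}) M"
  shows "reduced_state d m {1..<1} M = 1\<^sub>m 1"
proof -
  have "density_operator 1 (reduced_state d m {1..<1} M)"
    using reduced_state_density_operator[of 1 1 m d M] assms by simp
  then show ?thesis
    by (intro eq_matI) (auto simp: density_operator_def mat_trace_def One_nat_def)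
qed

text \<open>Here \<open>f i\<close> stands for the bond between sites \<open>i\<close> and
  \<open>i + 1\<close>, and \<open>g k\<close> for a bound on the first \<open>k\<close> sites. The
  first bond brings in two sites at once and is bounded outright.\<close>

lemma sum_le_telescope:
  fixes f g :: "nat \<Rightarrow> real"
  assumes "2 \<le> m" "f 1 \<le> g 2" "\<And>k. 2 \<le> k \<Longrightarrow> k < m \<Longrightarrow> f k \<le> g (k + 1) - g k"
  shows "(\<Sum>i\<in>{1..m-1}. f i) \<le> g m"
proof -
  obtain n where n: "m = n + 2" using assms(1) le_Suc_ex by (metis add.commute)
  have "(\<Sum>i\<in>{1..k+1}. f i) \<le> g (k + 2)" if "k \<le> n" for k
    using that
  proof (induction k)
    case 0
    then show ?case using assms(2) by (simp add: numeral_2_eq_2)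
  next
    case (Suc k)
    have "{1..Suc k + 1} = insert (k + 2) {1..k + 1}" by auto
    then have "(\<Sum>i\<in>{1..Suc k + 1}. f i) = f (k + 2) + (\<Sum>i\<in>{1..k + 1}. f i)" by simp
    moreover have "f (k + 2) \<le> g (k + 2 + 1) - g (k + 2)" using Suc.prems n by (intro assms(3)) auto
    ultimately show ?case using Suc by (simp add: One_nat_def)
  qed
  from this[of n] show ?thesis using n by (simp add: One_nat_def)
qed

context
  fixes d :: "nat \<Rightarrow> nat" and m :: nat and \<rho> :: "complex mat" and \<delta> :: real
begin

private abbreviation (input) "N \<equiv> sub_dim d {1..m}"
private abbreviation (input) "R M q s \<equiv> reduced_state d m {q..<s} M"

definition "perturbed_state = full_rank_perturbation N \<delta> \<rho>"

private abbreviation (input) "L q s \<equiv> mat_fun ln (R perturbed_state q s)"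

text \<open>\<open>neg_ent M q s\<close> is \<open>- ln 2\<close> times the entropy of the sites \<open>q, \<dots>, s - 1\<close>.\<close>

definition "neg_ent M q s = Re (mat_trace (R M q s * mat_fun ln (R M q s)))"
text \<open>\<open>neg_ent M q s - cross_ent M q s\<close> is the relative entropy, in nats, of the
  marginal of \<open>M\<close> to that of \<open>perturbed_state\<close>.\<close>

definition "cross_ent M q s = Re (mat_trace (R M q s * L q s))"

text \<open>The one-site term of site \<open>i\<close> is assigned to the bond on its right. Site 1
  is excluded and site \<open>m\<close> is never a left end, so exactly the interior sites
  contribute.\<close>

definition "local_term i = extend_op d m {i..<i + 2} (- L i (i + 2)) +
  (if i = 1 then 0\<^sub>m N N else extend_op d m {i..<i + 1} (L i (i + 1)))"

definition "local_hamiltonian = mat_sum N local_term {1..m-1}"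

context
  assumes m: "2 \<le> m" and \<rho>: "density_operator N \<rho>" and \<delta>: "0 < \<delta>" "\<delta> < 1"
begin

private lemma \<rho>_carrier: "\<rho> \<in> carrier_mat N N" and N_pos: "0 < N"
  using \<rho> density_operator_dim_pos[OF \<rho>] by (auto simp: density_operator_def)

lemma perturbed_state_carrier: "perturbed_state \<in> carrier_mat N N"
  using \<rho>_carrier by (simp add: perturbed_state_def full_rank_perturbation_def)

lemma reduced_perturbed_state:
  assumes "1 \<le> q" "q \<le> s" "s \<le> Suc m"
  shows "R perturbed_state q s = full_rank_perturbation (sub_dim d {q..<s}) \<delta> (R \<rho> q s)"
  unfolding perturbed_state_def by (rule reduced_state_full_rank_perturbation[OF assms \<rho>_carrier N_pos])

lemma reduced_perturbed_state_positive_definite: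
  assumes "1 \<le> q" "q \<le> s" "s \<le> Suc m"
  shows "positive_definite (R perturbed_state q s)"
  unfolding reduced_perturbed_state[OF assms]
  by (rule full_rank_perturbation_entropy(1)[OF reduced_state_density_operator[OF assms \<rho>] \<delta>])

lemma L_carrier:
  assumes "1 \<le> q" "q \<le> s" "s \<le> Suc m"
  shows "L q s \<in> carrier_mat (sub_dim d {q..<s}) (sub_dim d {q..<s})" "hermitian (L q s)"
proof -
  obtain U e where U: "diagonalizes (sub_dim d {q..<s}) U e (R perturbed_state q s)"
    using reduced_perturbed_state_positive_definite[OF assms] unfolding positive_definite_def by auto
  note lnU = diagonalizes_mat_fun[OF U, of ln]
  show "L q s \<in> carrier_mat (sub_dim d {q..<s}) (sub_dim d {q..<s})" "hermitian (L q s)"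
    by (rule diagonalizesD(5)[OF lnU], rule diagonalizes_hermitian[OF lnU])
qed

lemma cross_ent_bounds:
  assumes "1 \<le> q" "q \<le> s" "s \<le> Suc m"
  shows "cross_ent \<rho> q s \<le> neg_ent \<rho> q s" "neg_ent \<rho> q s + ln (1 - \<delta>) \<le> cross_ent \<rho> q s"
  unfolding cross_ent_def neg_ent_def reduced_perturbed_state[OF assms]
  by (rule full_rank_perturbation_entropy(2,3)[OF reduced_state_density_operator[OF assms \<rho>] \<delta>])+

text \<open>Applied to the Gibbs state it bounds the partition function; applied to
  \<open>\<rho>\<close> it yields strong subadditivity.\<close>

lemma neg_ent_submodular:
  assumes "1 \<le> q" "q \<le> p" "p \<le> s" "s \<le> Suc m" "density_operator N \<tau>"
  shows "neg_ent \<tau> 1 p - cross_ent \<tau> q p \<le> neg_ent \<tau> 1 s - cross_ent \<tau> q s"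
  unfolding neg_ent_def cross_ent_def
  using assms by (intro entropy_submodular_chain perturbed_state_carrier reduced_perturbed_state_positive_definite)
    (auto simp: density_operator_def)

lemma sub_entropy_interval:
  assumes "1 \<le> q" "q \<le> s" "s \<le> Suc m"
  shows "sub_entropy d m \<rho> {q..<s} = - neg_ent \<rho> q s / ln 2"
proof -
  have "R \<rho> q s \<in> carrier_mat (sub_dim d {q..<s}) (sub_dim d {q..<s})" "hermitian (R \<rho> q s)"
    using reduced_state_density_operator[OF assms \<rho>] unfolding density_operator_def positive_operator_def by blast+
  then obtain U e where U: "diagonalizes (sub_dim d {q..<s}) U e (R \<rho> q s)"
    using hermitian_diagonalizes by blast
  show ?thesis
    unfolding sub_entropy_def vn_entropy_def neg_ent_def mat_trace_mult_mat_log2(2)[OF U diagonalizesD(5)[OF U]] by simp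
qed

lemma cond_mutual_info_site:
  assumes "i \<in> {1..m}"
  shows "cond_mutual_info d m \<rho> {1..<i} {i<..m} {i} * ln 2 =
    neg_ent \<rho> 1 (Suc m) - neg_ent \<rho> i (Suc m) - neg_ent \<rho> 1 (i + 1) + neg_ent \<rho> i (i + 1)"
proof -
  have i: "1 \<le> i" "i \<le> m" using assms by simp_all
  have sets: "{1..<i} \<union> {i} = {1..<i + 1}" "{i} \<union> {i<..m} = {i..<Suc m}"
    "{1..<i + 1} \<union> {i<..m} = {1..<Suc m}" "{i} = {i..<i + 1}"
    using i by auto
  have "cond_mutual_info d m \<rho> {1..<i} {i<..m} {i} = sub_entropy d m \<rho> {1..<i + 1} + sub_entropy d m \<rho> {i..<Suc m}
      - sub_entropy d m \<rho> {1..<Suc m} - sub_entropy d m \<rho> {i..<i + 1}"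
    unfolding cond_mutual_info_def sets(1-3) using sets(4) by simp
  then show ?thesis using i by (simp add: sub_entropy_interval field_simps)
qed

lemma local_term_carrier: "local_term i \<in> carrier_mat N N"
  by (simp add: local_term_def)

lemma extend_op_hermitian:
  assumes "1 \<le> q" "q \<le> s" "s \<le> Suc m" "X \<in> carrier_mat (sub_dim d {q..<s}) (sub_dim d {q..<s})" "hermitian X"
  shows "hermitian (extend_op d m {q..<s} X)"
proof (rule hermitianI[OF extend_op_carrier])
  show "mat_adjoint (extend_op d m {q..<s} X) = extend_op d m {q..<s} X"
    unfolding extend_op_interval[OF assms(1-3)] using embed_adjoint[OF assms(4)] hermitianD(1)[OF assms(5)] by simp
qed

lemma local_term_hermitian:
  assumes "i \<in> {1..m-1}"
  shows "hermitian (local_term i)"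
proof (rule hermitianI[OF local_term_carrier])
  have i: "1 \<le> i" "i \<le> i + 2" "i + 2 \<le> Suc m" "i \<le> i + 1" "i + 1 \<le> Suc m" using assms m by auto
  have "hermitian (- L i (i + 2))"
    using L_carrier[OF i(1-3)] hermitianD(1) by (intro hermitianI) (auto simp: mat_adjoint_uminus)
  then have 1: "hermitian (extend_op d m {i..<i + 2} (- L i (i + 2)))"
    using L_carrier[OF i(1-3)] by (intro extend_op_hermitian[OF i(1-3)]) auto
  have 2: "hermitian (extend_op d m {i..<i + 1} (L i (i + 1)))"
    by (intro extend_op_hermitian[OF i(1,4,5)] L_carrier[OF i(1,4,5)])
  have "mat_adjoint (0\<^sub>m N N :: complex mat) = 0\<^sub>m N N" by (rule eq_matI) auto
  then show "mat_adjoint (local_term i) = local_term i"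
    unfolding local_term_def using hermitianD(1)[OF 1] hermitianD(1)[OF 2] by (simp add: mat_adjoint_add[of _ N N])
qed

lemma local_term_supported:
  assumes "i \<in> {1..m-1}"
  shows "supported_on d m {i, i + 1} (local_term i)"
proof -
  have i: "1 \<le> i" "i \<le> i + 2" "i + 2 \<le> Suc m" "i \<le> i + 1" "i + 1 \<le> Suc m" "i + 1 \<le> i + 2" using assms m by auto
  have set: "{i, i + 1} = {i..<i + 2}" by auto
  let ?a = "sub_dim d {1..<i}" and ?b = "sub_dim d {i..<i + 1}" and ?c = "sub_dim d {i + 1..<i + 2}"
    and ?e = "sub_dim d {i + 2..<Suc m}"
  have dims: "sub_dim d {i..<i + 2} = ?b * ?c" "sub_dim d {i + 1..<Suc m} = ?c * ?e"
    using sub_dim_interval_split[OF i(4,6), of d] sub_dim_interval_split[OF i(6,3), of d] by auto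
  \<comment> \<open>As an operator on the bond, the one-site logarithm is tensored with the identity
    on site \<open>i + 1\<close>.\<close>
  define X where "X = - L i (i + 2) + (if i = 1 then 0\<^sub>m (?b * ?c) (?b * ?c) else embed 1 ?b ?c (L i (i + 1)))"
  have L: "L i (i + 2) \<in> carrier_mat (?b * ?c) (?b * ?c)" "L i (i + 1) \<in> carrier_mat ?b ?b"
    using L_carrier(1)[OF i(1-3)] L_carrier(1)[OF i(1,4,5)] unfolding dims .
  have E: "embed 1 ?b ?c (L i (i + 1)) \<in> carrier_mat (?b * ?c) (?b * ?c)" by (rule embed_carrier) simp
  have X: "X \<in> carrier_mat (?b * ?c) (?b * ?c)" using L E by (simp add: X_def)
  have N: "N = ?a * (?b * ?c) * ?e" using sub_dim_chain[OF i(1-3), of d] unfolding dims .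
  have E1: "extend_op d m {i..<i + 1} (L i (i + 1)) = embed ?a (?b * ?c) ?e (embed 1 ?b ?c (L i (i + 1)))"
    using extend_op_interval[OF i(1,4,5), of d "L i (i + 1)"] embed_embed[of ?a 1 ?b ?c ?e "L i (i + 1)"]
    unfolding dims by simp
  have E2: "extend_op d m {i..<i + 2} (- L i (i + 2)) = embed ?a (?b * ?c) ?e (- L i (i + 2))"
    using extend_op_interval[OF i(1-3), of d] unfolding dims by simp
  have "embed ?a (?b * ?c) ?e X = embed ?a (?b * ?c) ?e (- L i (i + 2)) +
      embed ?a (?b * ?c) ?e (if i = 1 then 0\<^sub>m (?b * ?c) (?b * ?c) else embed 1 ?b ?c (L i (i + 1)))"
    unfolding X_def by (rule embed_add) (use L E in auto)
  also have "\<dots> = local_term i"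
    unfolding local_term_def E1 E2 N embed_zero[symmetric] by (cases "i = 1") (simp_all only: if_True if_False simp_thms)
  finally have "local_term i = embed ?a (?b * ?c) ?e X" by simp
  also have "\<dots> = extend_op d m {i, i + 1} X"
    unfolding set extend_op_interval[OF i(1-3)] dims ..
  finally show ?thesis
    unfolding supported_on_def set using X unfolding dims by (metis dims(1) set)
qed

lemma local_hamiltonian_carrier: "local_hamiltonian \<in> carrier_mat N N"
  by (simp add: local_hamiltonian_def)

lemma local_hamiltonian_hermitian: "hermitian local_hamiltonian"
  unfolding local_hamiltonian_def by (intro mat_sum_hermitian local_term_hermitian local_term_carrier)

lemma mat_trace_mult_local_hamiltonian:
  assumes "density_operator N M"
  shows "Re (mat_trace (M * local_hamiltonian)) = (\<Sum>i\<in>{1..m-1}. (if i = 1 then 0 else cross_ent M i (i + 1)) - cross_ent M i (i + 2))"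
proof -
  have M: "M \<in> carrier_mat N N" using assms by (simp add: density_operator_def)
  have "mat_trace (M * local_hamiltonian) = (\<Sum>i\<in>{1..m-1}. mat_trace (M * local_term i))"
    unfolding local_hamiltonian_def by (rule mat_trace_mult_mat_sum[OF M local_term_carrier])
  moreover have "Re (mat_trace (M * local_term i)) = (if i = 1 then 0 else cross_ent M i (i + 1)) - cross_ent M i (i + 2)"
    if "i \<in> {1..m-1}" for i
  proof -
    have i: "1 \<le> i" "i \<le> i + 2" "i + 2 \<le> Suc m" "i \<le> i + 1" "i + 1 \<le> Suc m" using that m by auto
    note L = L_carrier(1)[OF i(1-3)] L_carrier(1)[OF i(1,4,5)]
    have "mat_trace (M * extend_op d m {i..<i + 2} (- L i (i + 2))) = mat_trace (R M i (i + 2) * (- L i (i + 2)))"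
      using L by (intro mat_trace_mult_extend_op[OF i(1-3) M]) auto
    also have "\<dots> = - mat_trace (R M i (i + 2) * L i (i + 2))"
    proof -
      have "R M i (i + 2) * (- L i (i + 2)) = - (R M i (i + 2) * L i (i + 2))"
        using L(1) by (intro uminus_mult_right_mat) simp
      then show ?thesis
        using mat_trace_uminus[OF mult_square_carrier[OF reduced_state_carrier[OF refl] L(1)]] by simp
    qed
    finally have 1: "Re (mat_trace (M * extend_op d m {i..<i + 2} (- L i (i + 2)))) = - cross_ent M i (i + 2)"
      by (simp add: cross_ent_def)
    have 2: "Re (mat_trace (M * extend_op d m {i..<i + 1} (L i (i + 1)))) = cross_ent M i (i + 1)"
      unfolding mat_trace_mult_extend_op[OF i(1,4,5) M L(2)] cross_ent_def ..
    have 3: "mat_trace (M * 0\<^sub>m N N) = 0" using M by (simp add: mat_trace_def)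
    have "M * local_term i = M * extend_op d m {i..<i + 2} (- L i (i + 2)) +
        M * (if i = 1 then 0\<^sub>m N N else extend_op d m {i..<i + 1} (L i (i + 1)))"
      unfolding local_term_def using M by (intro mult_add_distrib_mat[of _ N N _ N]) auto
    then show ?thesis
      using 1 2 3 M by (simp add: mat_trace_add[of _ N] del: One_nat_def)
  qed
  ultimately show ?thesis by (simp add: Re_sum)
qed

section \<open>The partition function is at most 1\<close>

lemma reduced_perturbed_state_empty: "R perturbed_state 1 1 = 1\<^sub>m 1"
proof -
  have "R perturbed_state 1 1 = full_rank_perturbation 1 \<delta> (1\<^sub>m 1)"
    using reduced_perturbed_state[of 1 1] reduced_state_empty[OF \<rho>] m by simp
  also have "\<dots> = 1\<^sub>m 1" by (rule eq_matI) (auto simp: full_rank_perturbation_def)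
  finally show ?thesis .
qed

text \<open>Nonnegativity of the relative entropy on sites 1 and 2 is monotonicity down to the empty
  interval, where both marginals are the scalar 1.\<close>

lemma cross_ent_le_neg_ent:
  assumes "density_operator N \<tau>"
  shows "cross_ent \<tau> 1 3 \<le> neg_ent \<tau> 1 3"
proof -
  have "neg_ent \<tau> 1 1 = cross_ent \<tau> 1 1"
    unfolding neg_ent_def cross_ent_def reduced_state_empty[OF assms] reduced_perturbed_state_empty ..
  moreover have "neg_ent \<tau> 1 1 - cross_ent \<tau> 1 1 \<le> neg_ent \<tau> 1 3 - cross_ent \<tau> 1 3"
    using m by (intro neg_ent_submodular[OF _ _ _ _ assms]) auto
  ultimately show ?thesis by simp
qed

text \<open>The partial sums of \<open>- H\<close> telescope against the negative entropies of the initial segments,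
  each step being an instance of submodularity. For the Gibbs state \<open>\<tau>\<close> of \<open>H\<close> the last one says
  \<open>- Tr \<tau> H \<le> Tr \<tau> ln \<tau>\<close>, that is, \<open>ln Z \<le> 0\<close>.\<close>

lemma neg_ent_telescope:
  assumes \<tau>: "density_operator N \<tau>"
  shows "(\<Sum>i\<in>{1..m-1}. cross_ent \<tau> i (i + 2) - (if i = 1 then 0 else cross_ent \<tau> i (i + 1))) \<le> neg_ent \<tau> 1 (m + 1)"
proof (rule sum_le_telescope[where g = "\<lambda>k. neg_ent \<tau> 1 (k + 1)", OF m])
  show "cross_ent \<tau> 1 (1 + 2) - (if 1 = (1 :: nat) then 0 else cross_ent \<tau> 1 (1 + 1)) \<le> neg_ent \<tau> 1 (2 + 1)"
    using cross_ent_le_neg_ent[OF \<tau>] by (simp add: One_nat_def numeral_3_eq_3)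
next
  fix k :: nat assume k: "2 \<le> k" "k < m"
  then have "neg_ent \<tau> 1 (k + 1) - cross_ent \<tau> k (k + 1) \<le> neg_ent \<tau> 1 (k + 2) - cross_ent \<tau> k (k + 2)"
    by (intro neg_ent_submodular[OF _ _ _ _ \<tau>]) auto
  then show "cross_ent \<tau> k (k + 2) - (if k = 1 then 0 else cross_ent \<tau> k (k + 1)) \<le> neg_ent \<tau> 1 (k + 1 + 1) - neg_ent \<tau> 1 (k + 1)"
    using k(1) by (simp add: One_nat_def)
qed

lemma rel_entropy_gibbs_le:
  "rel_entropy \<rho> (gibbs_state local_hamiltonian) \<le> ereal ((neg_ent \<rho> 1 (Suc m) + Re (mat_trace (\<rho> * local_hamiltonian))) / ln 2)"
proof -
  obtain z where z: "0 < z"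
    "mat_fun ln (gibbs_state local_hamiltonian) = - local_hamiltonian + complex_of_real (- ln z) \<cdot>\<^sub>m 1\<^sub>m N"
    and \<tau>: "density_operator N (gibbs_state local_hamiltonian)"
    and D: "rel_entropy \<rho> (gibbs_state local_hamiltonian) = ereal ((Re (mat_trace (\<rho> * mat_fun ln \<rho>)) + Re (mat_trace (\<rho> * local_hamiltonian)) + ln z) / ln 2)"
    using rel_entropy_gibbs_state[OF \<rho> local_hamiltonian_carrier local_hamiltonian_hermitian] .
  let ?\<tau> = "gibbs_state local_hamiltonian"
  have \<tau>c: "?\<tau> \<in> carrier_mat N N" "mat_trace ?\<tau> = 1" using \<tau> by (auto simp: density_operator_def)
  have "Re (mat_trace (?\<tau> * mat_fun ln ?\<tau>)) = - Re (mat_trace (?\<tau> * local_hamiltonian)) - ln z"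
    unfolding z(2) mat_trace_mult_uminus_shift[OF \<tau>c(1) local_hamiltonian_carrier] using \<tau>c(2) by simp
  moreover have "- Re (mat_trace (?\<tau> * local_hamiltonian)) \<le> Re (mat_trace (?\<tau> * mat_fun ln ?\<tau>))"
  proof -
    have "- Re (mat_trace (?\<tau> * local_hamiltonian)) \<le> neg_ent ?\<tau> 1 (m + 1)"
      unfolding mat_trace_mult_local_hamiltonian[OF \<tau>] using neg_ent_telescope[OF \<tau>] by (simp flip: sum_negf)
    then show ?thesis using reduced_state_all[OF \<tau>c(1)] by (simp add: neg_ent_def One_nat_def)
  qed
  ultimately have "ln z \<le> 0" by simp
  then show ?thesis
    unfolding D using reduced_state_all[OF \<rho>_carrier] by (simp add: neg_ent_def divide_right_mono)
qed

end

end

text \<open>In \<open>neg_ent_submodular\<close> with \<open>\<tau> = \<rho>\<close>, the cross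
  terms differ from the entropies of \<open>\<rho>\<close> by an error that vanishes with the
  perturbation, so states of any rank are covered.\<close>

lemma neg_ent_strongly_subadditive:
  fixes d m \<rho>
  defines "R \<equiv> \<lambda>q s. reduced_state d m {q..<s} \<rho>"
  defines "E \<equiv> \<lambda>q s. Re (mat_trace (R q s * mat_fun ln (R q s)))"
  assumes m: "2 \<le> m" and \<rho>: "density_operator (sub_dim d {1..m}) \<rho>"
    and le: "1 \<le> q" "q \<le> p" "p \<le> s" "s \<le> Suc m"
  shows "E 1 p - E q p \<le> E 1 s - E q s"
proof (rule field_le_epsilon)
  fix e :: real assume e: "0 < e"
  \<comment> \<open>Chosen so that \<open>ln (1 - ?\<delta>) = - e\<close>, the whole error
    allowed.\<close>
  let ?\<delta> = "1 - exp (- e)"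
  have \<delta>: "0 < ?\<delta>" "?\<delta> < 1" using e by simp_all
  have "E q' s' = neg_ent d m \<rho> q' s'" for q' s'
    by (simp add: E_def R_def neg_ent_def)
  then show "E 1 p - E q p \<le> E 1 s - E q s + e"
    using neg_ent_submodular[OF m \<rho> \<delta> le \<rho>]
      cross_ent_bounds(1)[OF m \<rho> \<delta>, of q p] cross_ent_bounds(2)[OF m \<rho> \<delta>, of q s] le
    by simp
qed

theorem theorem1:
  fixes d :: "nat \<Rightarrow> nat" and m :: nat and \<epsilon> :: real and \<rho> :: "complex mat"
  assumes "2 \<le> m"
    and "0 < \<epsilon>"
    and "approx_markov_chain d m \<epsilon> \<rho>"
  shows "\<exists>(h :: nat \<Rightarrow> complex mat) H.
           (\<forall>i\<in>{1..m-1}. hermitian (h i) \<and> supported_on d m {i, i + 1} (h i)) \<and>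
           H = mat_sum (sub_dim d {1..m}) h {1..m-1} \<and>
           hermitian H \<and>
           rel_entropy \<rho> (gibbs_state H) \<le> ereal (\<epsilon> * real m)"
proof -
  have \<rho>: "density_operator (sub_dim d {1..m}) \<rho>" using assms(3) by (simp add: approx_markov_chain_def)
  \<comment> \<open>The perturbation cost granted per site; over \<open>m\<close> sites it adds up
    to one \<open>\<epsilon>\<close>, converted to nats.\<close>
  define \<kappa> where "\<kappa> = \<epsilon> * ln 2 / m"
  have \<kappa>: "\<kappa> > 0" using assms by (simp add: \<kappa>_def)
  define \<delta> where "\<delta> = 1 - exp (- \<kappa>)"
  have \<delta>: "0 < \<delta>" "\<delta> < 1" "ln (1 - \<delta>) = - \<kappa>" using \<kappa> by (simp_all add: \<delta>_def)
  note ctx = assms(1) \<rho> \<delta>(1,2)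
  let ?H = "local_hamiltonian d m \<rho> \<delta>"
  have cmi: "neg_ent d m \<rho> 1 (Suc m) - neg_ent d m \<rho> i (Suc m) - neg_ent d m \<rho> 1 (i + 1) + neg_ent d m \<rho> i (i + 1) \<le> \<epsilon> * ln 2"
    if i: "1 \<le> i" "i \<le> m" for i
  proof -
    have "cond_mutual_info d m \<rho> {1..<i} {i<..m} {i} \<le> \<epsilon>"
      using assms(3) i by (simp add: approx_markov_chain_def)
    then have "cond_mutual_info d m \<rho> {1..<i} {i<..m} {i} * ln 2 \<le> \<epsilon> * ln 2"
      by (rule mult_right_mono) simp
    then show ?thesis using cond_mutual_info_site[OF ctx, of i] i by simp
  qed
  have sum: "(\<Sum>i\<in>{1..m-1}. (if i = 1 then 0 else cross_ent d m \<rho> \<delta> \<rho> i (i + 1)) - cross_ent d m \<rho> \<delta> \<rho> i (i + 2))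
      \<le> - neg_ent d m \<rho> 1 (m + 1) + (real m - 2) * (\<epsilon> * ln 2) + m * \<kappa>"
  \<comment> \<open>Up to site \<open>k\<close> the bound allows one conditional mutual information
    for each of the sites \<open>2, ..., k - 1\<close> and one \<open>\<kappa>\<close> per site; the
    first bond needs only one of its two \<open>\<kappa>\<close>.\<close>
  proof (rule sum_le_telescope[where g = "\<lambda>k. - neg_ent d m \<rho> 1 (k + 1) + (real k - 2) * (\<epsilon> * ln 2) + k * \<kappa>", OF assms(1)])
    show "(if 1 = (1 :: nat) then 0 else cross_ent d m \<rho> \<delta> \<rho> 1 (1 + 1)) - cross_ent d m \<rho> \<delta> \<rho> 1 (1 + 2)
        \<le> - neg_ent d m \<rho> 1 (2 + 1) + (real 2 - 2) * (\<epsilon> * ln 2) + real 2 * \<kappa>"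
      using cross_ent_bounds(2)[OF ctx, of 1 3] \<delta>(3) assms(1) \<kappa> by (simp add: numeral_3_eq_3 One_nat_def)
  next
    fix k :: nat assume k: "2 \<le> k" "k < m"
    \<comment> \<open>The one-site term enters with a plus sign and costs nothing; only the two-site
      term pays \<open>\<kappa>\<close>.\<close>
    have "cross_ent d m \<rho> \<delta> \<rho> k (k + 1) \<le> neg_ent d m \<rho> k (k + 1)"
      using k by (intro cross_ent_bounds(1)[OF ctx]) auto
    moreover have "neg_ent d m \<rho> k (k + 2) - \<kappa> \<le> cross_ent d m \<rho> \<delta> \<rho> k (k + 2)"
      using cross_ent_bounds(2)[OF ctx, of k "k + 2"] \<delta>(3) k by simp
    \<comment> \<open>Discarding the sites beyond \<open>k + 1\<close> can only lower the
      conditional mutual information at site \<open>k\<close>, so the Markov condition, which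
      concerns the whole right part, applies.\<close>
    moreover have "neg_ent d m \<rho> 1 (k + 2) - neg_ent d m \<rho> k (k + 2) \<le> neg_ent d m \<rho> 1 (Suc m) - neg_ent d m \<rho> k (Suc m)"
      unfolding neg_ent_def using k by (intro neg_ent_strongly_subadditive assms(1) \<rho>) auto
    moreover have "neg_ent d m \<rho> 1 (Suc m) - neg_ent d m \<rho> k (Suc m) - neg_ent d m \<rho> 1 (k + 1) + neg_ent d m \<rho> k (k + 1) \<le> \<epsilon> * ln 2"
      using k by (intro cmi) auto
    ultimately show "(if k = 1 then 0 else cross_ent d m \<rho> \<delta> \<rho> k (k + 1)) - cross_ent d m \<rho> \<delta> \<rho> k (k + 2)
        \<le> - neg_ent d m \<rho> 1 (k + 1 + 1) + (real (k + 1) - 2) * (\<epsilon> * ln 2) + real (k + 1) * \<kappa>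
          - (- neg_ent d m \<rho> 1 (k + 1) + (real k - 2) * (\<epsilon> * ln 2) + real k * \<kappa>)"
      using k(1) by (simp add: algebra_simps One_nat_def)
  qed
  have "neg_ent d m \<rho> 1 (Suc m) + Re (mat_trace (\<rho> * ?H)) \<le> (real m - 2) * (\<epsilon> * ln 2) + m * \<kappa>"
    using sum unfolding mat_trace_mult_local_hamiltonian[OF ctx \<rho>] by (simp add: One_nat_def)
  \<comment> \<open>The total spent is \<open>m - 2\<close> multiples of
    \<open>\<epsilon> * ln 2\<close> for the Markov condition and one for the perturbation.\<close>
  also have "\<dots> \<le> \<epsilon> * real m * ln 2"
  proof -
    have "m * \<kappa> = \<epsilon> * ln 2" using assms(1) by (simp add: \<kappa>_def)
    moreover have "0 < \<epsilon> * ln 2" using assms(2) by simp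
    ultimately show ?thesis by (simp add: algebra_simps)
  qed
  finally have "(neg_ent d m \<rho> 1 (Suc m) + Re (mat_trace (\<rho> * ?H))) / ln 2 \<le> \<epsilon> * real m"
    by (simp add: pos_divide_le_eq)
  then have "rel_entropy \<rho> (gibbs_state ?H) \<le> ereal (\<epsilon> * real m)"
    using rel_entropy_gibbs_le[OF ctx] order_trans by (metis ereal_less_eq(3))
  moreover have "\<forall>i\<in>{1..m-1}. hermitian (local_term d m \<rho> \<delta> i) \<and> supported_on d m {i, i + 1} (local_term d m \<rho> \<delta> i)"
    using local_term_hermitian[OF ctx] local_term_supported[OF ctx] by blast
  ultimately show ?thesis using local_hamiltonian_hermitian[OF ctx] local_hamiltonian_def by blast
qed

end
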